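(* Let $\Gamma\subset SL(2,\mathbb{R})$ be a non-uniform lattice and $X=SL(2,\mathbb{R})/\Gamma$. Fix $x_0\in X$, and suppose $x\in X$ is not cuspidal. Then $$\limsup_{|s|\to\infty}\frac{d(h_sx,x_0)}{\log|s|}=1+\limsup_{t\to\infty}\frac{d(g_tx,x_0)}{t}.$$
   Context: A non-uniform lattice is a discrete subgroup $\Gamma$ of $SL(2,\mathbb{R})$ with $SL(2,\mathbb{R})/\Gamma$ of finite volume and non-compact. $X=SL(2,\mathbb{R})/\Gamma$ is viewed as the unit tangent bundle of the hyperbolic orbifold $\mathbb{H}^2/\Gamma=SO(2)\backslash SL(2,\mathbb{R})/\Gamma$, with the hyperbolic metric normalized to have curvature $-1$. For $x,y\in X$, $d(x,y)$ denotes the hyperbolic distance between their projections to $\mathbb{H}^2/\Gamma$. The one-parameter groups $$g_t=\begin{pmatrix}e^{t/2}&0\\0&e^{-t/2}\end{pmatrix},\qquad h_s=\begin{pmatrix}1&0\\ s&1\end{pmatrix}$$ act on $X$ by left multiplication; $H=\{h_s:s\in\mathbb{R}\}$. A point $x\in X$ is called cuspidal if $Hx$ is closed in $X$, equivalently if $\{g_tx\}_{t\ge0}$ is divergent in $X$ (leaves every compact set). *)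

theory Defs
  imports "HOL-Analysis.Analysis" "HOL-Algebra.Left_Coset"
begin

definition SL2R :: "(real^2^2) monoid" where
  "SL2R = \<lparr>carrier = {A. det A = 1}, mult = (**), one = mat 1\<rparr>"

lemma SL2R_simps [simp]:
  "A \<in> carrier SL2R \<longleftrightarrow> det A = 1"
  "A \<otimes>\<^bsub>SL2R\<^esub> B = A ** B"
  "\<one>\<^bsub>SL2R\<^esub> = mat 1"
  by (simp_all add: SL2R_def)

lemma group_SL2R: "group SL2R"
proof (rule groupI)
  fix A assume A: "A \<in> carrier SL2R"
  then have "invertible A" by (simp add: invertible_det_nz)
  then obtain B where B: "B ** A = mat 1" by (auto simp: invertible_def)
  then have "det B * det A = 1" by (metis det_mul det_I)
  with A have "B \<in> carrier SL2R" by simp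
  with B show "\<exists>B\<in>carrier SL2R. B \<otimes>\<^bsub>SL2R\<^esub> A = \<one>\<^bsub>SL2R\<^esub>" by auto
qed (auto simp: det_mul matrix_mul_assoc)

text \<open>
  The space \<open>X = SL(2,\<real>) / \<Gamma>\<close> is the set of left cosets \<open>lcosets\<^bsub>SL2R\<^esub> \<Gamma>\<close>; a matrix \<open>a\<close> acts on a
  point \<open>x\<close> (a coset) by \<open>a <#\<^bsub>SL2R\<^esub> x\<close>, as \<open>a (g \<Gamma>) = (a g) \<Gamma>\<close>. It carries the quotient topology
  of the topology of \<open>SL(2,\<real>)\<close> as a subspace of the Euclidean space of matrices.
\<close>

definition coset_topology :: "(real^2^2) set \<Rightarrow> (real^2^2) set topology" where
  "coset_topology \<Gamma> = topology (\<lambda>U. U \<subseteq> lcosets\<^bsub>SL2R\<^esub> \<Gamma> \<and>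
     openin (top_of_set (carrier SL2R)) {g \<in> carrier SL2R. g <#\<^bsub>SL2R\<^esub> \<Gamma> \<in> U})"

lemma openin_coset_topology:
  "openin (coset_topology \<Gamma>) U \<longleftrightarrow> U \<subseteq> lcosets\<^bsub>SL2R\<^esub> \<Gamma> \<and>
     openin (top_of_set (carrier SL2R)) {g \<in> carrier SL2R. g <#\<^bsub>SL2R\<^esub> \<Gamma> \<in> U}"
proof -
  let ?P = "\<lambda>U. {g \<in> carrier SL2R. g <#\<^bsub>SL2R\<^esub> \<Gamma> \<in> U}"
  have 1: "?P (S \<inter> T) = ?P S \<inter> ?P T" for S T by auto
  have 2: "?P (\<Union>K) = \<Union>(?P ` K)" for K by auto
  have "istopology (\<lambda>U. U \<subseteq> lcosets\<^bsub>SL2R\<^esub> \<Gamma> \<and> openin (top_of_set (carrier SL2R)) (?P U))"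
    unfolding istopology_def 1 2 by (intro conjI allI impI openin_Int openin_Union) auto
  then show ?thesis
    by (simp add: coset_topology_def topology_inverse')
qed

lemma quotient_map_coset_topology:
  "quotient_map (top_of_set (carrier SL2R)) (coset_topology \<Gamma>) (\<lambda>g. g <#\<^bsub>SL2R\<^esub> \<Gamma>)"
proof -
  have "{g \<in> carrier SL2R. g <#\<^bsub>SL2R\<^esub> \<Gamma> \<in> lcosets\<^bsub>SL2R\<^esub> \<Gamma>} = carrier SL2R"
    by (auto simp: LCOSETS_def)
  then have "openin (coset_topology \<Gamma>) (lcosets\<^bsub>SL2R\<^esub> \<Gamma>)"
    using openin_topspace[of "top_of_set (carrier SL2R)"]
    by (simp only: openin_coset_topology topspace_euclidean_subtopology subset_refl simp_thms)
  moreover have "U \<subseteq> lcosets\<^bsub>SL2R\<^esub> \<Gamma>" if "openin (coset_topology \<Gamma>) U" for U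
    using that by (simp only: openin_coset_topology)
  ultimately have "topspace (coset_topology \<Gamma>) = lcosets\<^bsub>SL2R\<^esub> \<Gamma>"
    by (metis openin_subset openin_topspace subset_antisym)
  then show ?thesis
    unfolding quotient_map_def openin_coset_topology
    by (auto simp: LCOSETS_def)
qed

text \<open>
  Haar measure on \<open>SL(2,\<real>)\<close> by the cone construction: the measure of \<open>B\<close> is the Lebesgue measure
  in \<open>\<real>\<^sup>4\<close> of the cone \<open>{r A | 0 < r \<le> 1, A \<in> B}\<close>. Left and right multiplication by a matrix \<open>g\<close>
  maps cones to cones and has determinant \<open>(det g)\<^sup>2 = 1\<close> on \<open>\<real>\<^sup>4\<close>, so this measure is bi-invariant.
\<close>

definition haar_SL2R :: "(real^2^2) measure" where
  "haar_SL2R = distr (restrict_space lborel {A. 0 < det A \<and> det A \<le> 1}) borel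
                 (\<lambda>A. (1 / sqrt (det A)) *\<^sub>R A)"

lemma emeasure_haar_SL2R:
  assumes "B \<in> sets borel" "B \<subseteq> carrier SL2R"
  shows "emeasure haar_SL2R B = emeasure lborel {r *\<^sub>R A | r A. 0 < r \<and> r \<le> 1 \<and> A \<in> B}"
proof -
  let ?D = "{A::real^2^2. 0 < det A \<and> det A \<le> 1}"
  let ?f = "\<lambda>A::real^2^2. (1 / sqrt (det A)) *\<^sub>R A"
  have det: "(\<lambda>A::real^2^2. det A) \<in> borel_measurable borel"
    by (intro borel_measurable_continuous_onI) (simp add: det_2 continuous_intros)
  then have D: "?D \<in> sets borel" by measurable
  have f: "?f \<in> borel_measurable (restrict_space lborel ?D)"
    by (rule measurable_restrict_space1) (use det in measurable)
  have dsc: "det (r *\<^sub>R A) = r\<^sup>2 * det A" for r and A :: "real^2^2"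
    by (simp add: det_2 power2_eq_square algebra_simps)
  have "?f -` B \<inter> ?D = {r *\<^sub>R A | r A. 0 < r \<and> r \<le> 1 \<and> A \<in> B}"
  proof (intro equalityI subsetI)
    fix A assume A: "A \<in> ?f -` B \<inter> ?D"
    then have "A = sqrt (det A) *\<^sub>R ?f A" "0 < sqrt (det A)" "sqrt (det A) \<le> 1" "?f A \<in> B"
      by auto
    then show "A \<in> {r *\<^sub>R A | r A. 0 < r \<and> r \<le> 1 \<and> A \<in> B}" by blast
  next
    fix C assume "C \<in> {r *\<^sub>R A | r A. 0 < r \<and> r \<le> 1 \<and> A \<in> B}"
    then obtain r A where C: "C = r *\<^sub>R A" "0 < r" "r \<le> 1" "A \<in> B" by blast
    with assms(2) have "det A = 1" by auto
    with C have "det C = r\<^sup>2" by (simp add: dsc)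
    with C show "C \<in> ?f -` B \<inter> ?D" by (auto simp: power_le_one)
  qed
  moreover have "emeasure haar_SL2R B = emeasure (restrict_space lborel ?D) (?f -` B \<inter> ?D)"
    unfolding haar_SL2R_def using f assms(1)
    by (subst emeasure_distr) (auto simp: space_restrict_space)
  moreover have "\<dots> = emeasure lborel (?f -` B \<inter> ?D)"
    by (rule emeasure_restrict_space) (use D in auto)
  ultimately show ?thesis by simp
qed

definition fundamental_domain :: "(real^2^2) set \<Rightarrow> (real^2^2) set \<Rightarrow> bool" where
  "fundamental_domain \<Gamma> F \<longleftrightarrow> F \<in> sets borel \<and> F \<subseteq> carrier SL2R \<and>
     (\<forall>x \<in> lcosets\<^bsub>SL2R\<^esub> \<Gamma>. \<exists>!g. g \<in> F \<inter> x)"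

text \<open>
  The volume of \<open>SL(2,\<real>) / \<Gamma>\<close> for discrete \<open>\<Gamma>\<close> is the Haar measure of a fundamental domain, and does not
  depend on its choice.
\<close>

definition nonuniform_lattice :: "(real^2^2) set \<Rightarrow> bool" where
  "nonuniform_lattice \<Gamma> \<longleftrightarrow> subgroup \<Gamma> SL2R \<and> discrete \<Gamma> \<and>
     (\<exists>F. fundamental_domain \<Gamma> F \<and> emeasure haar_SL2R F < \<infinity>) \<and>
     \<not> compact_space (coset_topology \<Gamma>)"

definition g_mat :: "real \<Rightarrow> real^2^2" where
  "g_mat t = vector [vector [exp (t/2), 0], vector [0, exp (- t/2)]]"

definition h_mat :: "real \<Rightarrow> real^2^2" where
  "h_mat s = vector [vector [1, 0], vector [s, 1]]"

definition cuspidal :: "(real^2^2) set \<Rightarrow> (real^2^2) set \<Rightarrow> bool" where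
  "cuspidal \<Gamma> x \<longleftrightarrow> closedin (coset_topology \<Gamma>) (range (\<lambda>s. h_mat s <#\<^bsub>SL2R\<^esub> x))"

definition moebius :: "real^2^2 \<Rightarrow> complex \<Rightarrow> complex" where
  "moebius A z = (of_real (A$1$1) * z + of_real (A$1$2)) / (of_real (A$2$1) * z + of_real (A$2$2))"

text \<open>The distance of the metric \<open>(dx\<^sup>2 + dy\<^sup>2) / y\<^sup>2\<close>, of curvature \<open>-1\<close>, on the upper half-plane.\<close>

definition hyp_dist :: "complex \<Rightarrow> complex \<Rightarrow> real" where
  "hyp_dist z w = arcosh (1 + (cmod (z - w))\<^sup>2 / (2 * Im z * Im w))"

text \<open>
  \<open>SO(2) g \<mapsto> g\<^sup>-\<^sup>1 \<i>\<close> identifies \<open>SO(2) \ SL(2,\<real>)\<close> with the upper half-plane, and turns right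
  multiplication by \<open>\<gamma>\<close> into the Moebius action of \<open>\<gamma>\<^sup>-\<^sup>1\<close>. So a coset \<open>x = g \<Gamma>\<close> projects to a
  \<open>\<Gamma>\<close>-orbit in the upper half-plane, i.e. to a point of the orbifold. The distance between two
  points of the orbifold is the distance between the orbits.
\<close>

definition orbifold_proj :: "(real^2^2) set \<Rightarrow> complex set" where
  "orbifold_proj x = (\<lambda>g. moebius (inv\<^bsub>SL2R\<^esub> g) \<i>) ` x"

definition orbifold_dist :: "(real^2^2) set \<Rightarrow> (real^2^2) set \<Rightarrow> real" where
  "orbifold_dist x y = (INF (z, w) \<in> orbifold_proj x \<times> orbifold_proj y. hyp_dist z w)"

end

theory Submission
  imports Defs
begin

text \<open>
  Write \<open>x = g \<Gamma>\<close>. The distance of \<open>a x\<close> from \<open>x\<^sub>0\<close> is \<open>2 ln |a g \<gamma>|\<close>, minimised over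
  \<open>\<gamma> \<in> \<Gamma>\<close>, up to a bounded error (\<open>orbifold_dist_bounds\<close>; the norm is the Euclidean norm of
  the entries). Since \<open>h\<^sub>s = g\<^sub>-\<^sub>t h\<^sub>\<plusminus>\<^sub>1 g\<^sub>t\<close> for \<open>t = ln |s|\<close>, and \<open>g\<^sub>-\<^sub>t\<close> moves points by at most
  \<open>t\<close>, the distance of \<open>h\<^sub>s x\<close> is at most that of \<open>g\<^sub>t x\<close> plus \<open>t\<close>, plus a constant. This gives
  one inequality.

  For the other one, cusps are described as for \<open>SL(2,\<int>)\<close>, where they belong to primitive
  vectors of \<open>\<int>\<^sup>2\<close>. To each parabolic \<open>\<gamma> \<in> \<Gamma>\<close>, whose traceless part is up to sign of the form
  \<open>v (J v)\<^sup>T\<close> with \<open>J\<close> a rotation by a right angle, belongs the vector \<open>v\<close>. The set of these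
  vectors (\<open>par_vecs\<close>) is invariant under \<open>\<Gamma>\<close>, and a point is far out exactly when it sees a
  short one: for each \<open>a \<in> SL(2,\<real>)\<close>,

    \<^item> \<open>|a \<gamma>| |a v| \<ge> c\<close> for all \<open>\<gamma> \<in> \<Gamma>\<close> and all parabolic vectors \<open>v\<close> (\<open>par_vecs_depth_bound\<close>), and
    \<^item> \<open>|a \<gamma>| |a v| \<le> C\<close> for some \<open>\<gamma> \<in> \<Gamma>\<close> and some parabolic vector \<open>v\<close> (\<open>par_vecs_short\<close>).

  Given \<open>t\<close>, take \<open>\<gamma>\<close> and \<open>v\<close> from the second statement for \<open>a = g\<^sub>t g\<close>, and let
  \<open>(p, q) = g v\<close>. If \<open>p = 0\<close>, then the stabiliser of \<open>x\<close> contains some \<open>h\<^sub>s\<close> with \<open>s \<noteq> 0\<close>, and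
  \<open>x\<close> is cuspidal (\<open>cuspidal_if_vertical\<close>). Otherwise \<open>s = - q / p\<close> turns \<open>(p, q)\<close> into
  \<open>h\<^sub>s (p, q) = (p, 0)\<close>, and \<open>g\<^sub>t (p, q) = (e\<^bsup>t/2\<^esup> p, e\<^bsup>-t/2\<^esup> q)\<close>. The two statements then bound
  the distance of \<open>h\<^sub>s x\<close> from below and \<open>ln |s|\<close> from above, in terms of \<open>t\<close> and of the distance
  of \<open>g\<^sub>t x\<close>; \<open>limsup_growth\<close> draws the conclusion.

  The first statement only uses that \<open>\<Gamma>\<close> is discrete. The second one is the structure of
  \<open>SL(2,\<real>) / \<Gamma>\<close> near infinity, and rests on two facts. Small elements of a discrete group
  commute (Zassenhaus, \<open>small_parallel\<close>); and the points with no small element but \<open>\<plusminus>1\<close> in their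
  stabiliser form a bounded set, as finite volume leaves room for finitely many disjoint balls
  only (\<open>thick_bounded\<close>).
\<close>

section \<open>Two by two matrices\<close>

lemma mat2_eq_iff:
  fixes A B :: "real^2^2"
  shows "A = B \<longleftrightarrow> A$1$1 = B$1$1 \<and> A$1$2 = B$1$2 \<and> A$2$1 = B$2$1 \<and> A$2$2 = B$2$2"
  by (auto simp: vec_eq_iff forall_2)

lemma mat2_mult_nth:
  fixes A B :: "real^2^2"
  shows "(A ** B)$i$j = A$i$1 * B$1$j + A$i$2 * B$2$j"
  by (simp add: matrix_matrix_mult_def sum_2)

lemma mat2_vec_nth:
  fixes A :: "real^2^2"
  shows "(A *v x)$i = A$i$1 * x$1 + A$i$2 * x$2"
  by (simp add: matrix_vector_mult_def sum_2)

lemma norm_vec2_sq: "(norm (x::real^2))\<^sup>2 = (x$1)\<^sup>2 + (x$2)\<^sup>2"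
  unfolding power2_norm_eq_inner inner_vec_def sum_2 by (simp add: power2_eq_square)

lemma norm_mat2_sq:
  "(norm (A::real^2^2))\<^sup>2 = (A$1$1)\<^sup>2 + (A$1$2)\<^sup>2 + (A$2$1)\<^sup>2 + (A$2$2)\<^sup>2"
  unfolding power2_norm_eq_inner inner_vec_def sum_2 by (simp add: power2_eq_square)

lemma mat2_one_nth [simp]:
  "(mat 1 :: real^2^2)$1$1 = 1" "(mat 1 :: real^2^2)$1$2 = 0"
  "(mat 1 :: real^2^2)$2$1 = 0" "(mat 1 :: real^2^2)$2$2 = 1"
  by (simp_all add: mat_def)

lemma cauchy_schwarz_2: "(a*e + b*g)\<^sup>2 \<le> (a\<^sup>2 + b\<^sup>2) * (e\<^sup>2 + g\<^sup>2)" for a b e g :: real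
proof -
  have "(a\<^sup>2 + b\<^sup>2) * (e\<^sup>2 + g\<^sup>2) - (a*e + b*g)\<^sup>2 = (a*g - b*e)\<^sup>2" by algebra
  then show ?thesis by (smt (verit) zero_le_power2)
qed

lemma norm_mat2_mult_le: "norm (A ** B) \<le> norm A * norm (B::real^2^2)" for A :: "real^2^2"
proof (rule power2_le_imp_le)
  show "(norm (A ** B))\<^sup>2 \<le> (norm A * norm B)\<^sup>2"
    unfolding power_mult_distrib norm_mat2_sq mat2_mult_nth
    using cauchy_schwarz_2[of "A$1$1" "B$1$1" "A$1$2" "B$2$1"]
      cauchy_schwarz_2[of "A$1$1" "B$1$2" "A$1$2" "B$2$2"]
      cauchy_schwarz_2[of "A$2$1" "B$1$1" "A$2$2" "B$2$1"]
      cauchy_schwarz_2[of "A$2$1" "B$1$2" "A$2$2" "B$2$2"]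
    by (simp add: algebra_simps)
qed simp

lemma norm_mat2_vec_le: "norm (A *v x) \<le> norm A * norm x" for A :: "real^2^2"
proof (rule power2_le_imp_le)
  show "(norm (A *v x))\<^sup>2 \<le> (norm A * norm x)\<^sup>2"
    unfolding power_mult_distrib norm_mat2_sq norm_vec2_sq mat2_vec_nth
    using cauchy_schwarz_2[of "A$1$1" "x$1" "A$1$2" "x$2"]
      cauchy_schwarz_2[of "A$2$1" "x$1" "A$2$2" "x$2"]
    by (simp add: algebra_simps)
qed simp

text \<open>The adjugate, which is the inverse on \<open>SL(2,\<real>)\<close> and, unlike it, linear on all matrices.\<close>

definition adj :: "real^2^2 \<Rightarrow> real^2^2" where
  "adj A = vector [vector [A$2$2, - A$1$2], vector [- A$2$1, A$1$1]]"

lemma adj_nth [simp]: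
  "adj A$1$1 = A$2$2" "adj A$1$2 = - A$1$2" "adj A$2$1 = - A$2$1" "adj A$2$2 = A$1$1"
  by (simp_all add: adj_def)

lemma adj_mult: "adj (A ** B) = adj B ** adj A"
  by (simp add: mat2_eq_iff mat2_mult_nth algebra_simps)

lemma adj_adj [simp]: "adj (adj A) = A"
  by (simp add: mat2_eq_iff)

lemma det_adj [simp]: "det (adj A) = det A"
  by (simp add: det_2 algebra_simps)

lemma norm_adj [simp]: "norm (adj A) = norm A"
proof -
  have "(norm (adj A))\<^sup>2 = (norm A)\<^sup>2" by (simp add: norm_mat2_sq)
  then show ?thesis by simp
qed

lemma adj_right: "det A = 1 \<Longrightarrow> A ** adj A = mat 1"
  by (simp add: mat2_eq_iff mat2_mult_nth det_2 algebra_simps)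

lemma adj_left: "det A = 1 \<Longrightarrow> adj A ** A = mat 1"
  by (simp add: mat2_eq_iff mat2_mult_nth det_2 algebra_simps)

lemma adj_right_mult: "det A = 1 \<Longrightarrow> A ** (adj A ** B) = B"
  by (simp add: adj_right matrix_mul_assoc)

lemma adj_left_mult: "det A = 1 \<Longrightarrow> adj A ** (A ** B) = B"
  by (simp add: adj_left matrix_mul_assoc)

lemma norm_det1_ge: "det A = 1 \<Longrightarrow> 2 \<le> (norm (A::real^2^2))\<^sup>2"
proof -
  assume "det A = 1"
  then have "(norm A)\<^sup>2 - 2 = (A$1$1 - A$2$2)\<^sup>2 + (A$1$2 + A$2$1)\<^sup>2"
    unfolding norm_mat2_sq det_2 by algebra
  then show ?thesis by (smt (verit) zero_le_power2)
qed

lemma norm_det1_ge1: "det A = 1 \<Longrightarrow> 1 \<le> norm (A::real^2^2)"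
  using norm_det1_ge[of A] by (smt (verit) norm_ge_zero power_le_one)

lemma ln_norm_mat2_mult_le:
  fixes A B :: "real^2^2"
  assumes "det A = 1" "det B = 1"
  shows "ln (norm (A ** B)) \<le> ln (norm A) + ln (norm B)"
proof -
  have n: "1 \<le> norm A" "1 \<le> norm B" "1 \<le> norm (A ** B)"
    using assms by (auto intro!: norm_det1_ge1 simp: det_mul)
  then have "ln (norm (A ** B)) \<le> ln (norm A * norm B)"
    using norm_mat2_mult_le[of A B] by (subst ln_le_cancel_iff) linarith+
  also have "\<dots> = ln (norm A) + ln (norm B)" using n by (subst ln_mult) auto
  finally show ?thesis .
qed

lemma abs_nth_le_norm_mat2: "\<bar>(A::real^2^2)$i$j\<bar> \<le> norm A"
  by (rule order_trans[OF component_le_norm_cart Finite_Cartesian_Product.norm_nth_le])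

lemma continuous_on_mat2_mult [continuous_intros]:
  fixes f g :: "'a::topological_space \<Rightarrow> real^2^2"
  assumes "continuous_on S f" "continuous_on S g"
  shows "continuous_on S (\<lambda>x. f x ** g x)"
  using assms unfolding matrix_matrix_mult_def by (intro continuous_intros)

lemma tendsto_mat2_mult:
  fixes f g :: "'a \<Rightarrow> real^2^2"
  assumes "(f \<longlongrightarrow> a) F" "(g \<longlongrightarrow> b) F"
  shows "((\<lambda>x. f x ** g x) \<longlongrightarrow> a ** b) F"
  using assms unfolding matrix_matrix_mult_def by (intro tendsto_intros)

lemma linear_adj: "linear adj"
  by (rule linearI) (simp_all add: mat2_eq_iff)

lemma det_scaleR_mat2: "det (r *\<^sub>R A) = r\<^sup>2 * det (A::real^2^2)"
  by (simp add: det_2 power2_eq_square algebra_simps)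

section \<open>Traceless parts\<close>

text \<open>
  The size of a group element is measured by its traceless part: this vanishes exactly
  on \<open>\<plusminus>1\<close>, is equivariant under conjugation, and commuting elements have parallel
  traceless parts.
\<close>

definition tlp :: "real^2^2 \<Rightarrow> real^2^2" where
  "tlp A = A - ((A$1$1 + A$2$2) / 2) *\<^sub>R mat 1"

lemma tlp_nth [simp]:
  "tlp A$1$1 = (A$1$1 - A$2$2) / 2" "tlp A$1$2 = A$1$2" "tlp A$2$1 = A$2$1"
  "tlp A$2$2 = - ((A$1$1 - A$2$2) / 2)"
  by (simp_all add: tlp_def field_simps)

lemma tlp_conj:
  assumes "det g = 1"
  shows "tlp (g ** A ** adj g) = g ** tlp A ** adj g"
proof -
  have "(g ** A ** adj g)$1$1 + (g ** A ** adj g)$2$2 = det g * (A$1$1 + A$2$2)"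
    by (simp add: mat2_mult_nth det_2 algebra_simps)
  moreover have "g ** (A - c *\<^sub>R mat 1) ** adj g = g ** A ** adj g - c *\<^sub>R mat 1" for c
  proof -
    have "g ** (A - c *\<^sub>R mat 1) ** adj g = g ** A ** adj g - c *\<^sub>R (g ** adj g)"
      by (simp add: mat2_eq_iff mat2_mult_nth algebra_simps)
    then show ?thesis using assms by (simp add: adj_right)
  qed
  ultimately show ?thesis using assms by (simp add: tlp_def)
qed

lemma norm_tlp_le: "norm (tlp A) \<le> norm (A - c *\<^sub>R mat 1)"
proof (rule power2_le_imp_le)
  have "(norm (A - c *\<^sub>R mat 1))\<^sup>2 - (norm (tlp A))\<^sup>2 = (A$1$1 + A$2$2 - 2*c)\<^sup>2 / 2"
    unfolding norm_mat2_sq by (simp add: field_simps power2_eq_square)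
  then show "(norm (tlp A))\<^sup>2 \<le> (norm (A - c *\<^sub>R mat 1))\<^sup>2"
    by (smt (verit) zero_le_power2 divide_nonneg_pos)
qed simp

lemma norm_det1_eq: "det A = 1 \<Longrightarrow> (norm A)\<^sup>2 = 2 - 2 * det (tlp A) + (norm (tlp A))\<^sup>2"
  unfolding det_2 norm_mat2_sq tlp_nth by (simp add: field_simps power2_eq_square)

lemma abs_det_mat2_le: "2 * \<bar>det A\<bar> \<le> (norm (A::real^2^2))\<^sup>2"
proof -
  have "(norm A)\<^sup>2 - 2 * det A = (A$1$1 - A$2$2)\<^sup>2 + (A$1$2 + A$2$1)\<^sup>2"
    "(norm A)\<^sup>2 + 2 * det A = (A$1$1 + A$2$2)\<^sup>2 + (A$1$2 - A$2$1)\<^sup>2"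
    unfolding norm_mat2_sq det_2 by algebra+
  then show ?thesis by (smt (verit) zero_le_power2)
qed

lemma norm_det1_le_tlp: "det A = 1 \<Longrightarrow> (norm A)\<^sup>2 \<le> 2 + 2 * (norm (tlp A))\<^sup>2"
  using norm_det1_eq[of A] abs_det_mat2_le[of "tlp A"] by linarith

lemma tlp_zero_imp:
  assumes "det A = 1" "tlp A = 0"
  shows "A = mat 1 \<or> A = - mat 1"
proof -
  have e: "A$1$2 = 0" "A$2$1 = 0" "A$1$1 = A$2$2"
    using assms(2) tlp_nth[of A] by (simp_all add: mat2_eq_iff)
  with assms(1) have "(A$2$2)\<^sup>2 = 1" by (simp add: det_2 power2_eq_square)
  then have "A$2$2 = 1 \<or> A$2$2 = -1" by (simp add: power2_eq_1_iff)
  with e show ?thesis by (auto simp: mat2_eq_iff)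
qed

lemma tlp_commute_parallel:
  assumes "A ** B = B ** A" "tlp A \<noteq> 0"
  shows "\<exists>\<beta>. tlp B = \<beta> *\<^sub>R tlp A"
proof -
  define a b c where abc: "a = tlp A$1$1" "b = A$1$2" "c = A$2$1"
  define x y z where xyz: "x = tlp B$1$1" "y = B$1$2" "z = B$2$1"
  have 1: "b * z = y * c"
    using arg_cong[OF assms(1), of "\<lambda>M. M$1$1"] by (simp add: mat2_mult_nth abc xyz mult.commute)
  have 2: "a * y = x * b"
    using arg_cong[OF assms(1), of "\<lambda>M. M$1$2"]
    by (simp add: mat2_mult_nth abc xyz field_simps)
  have 3: "a * z = x * c"
    using arg_cong[OF assms(1), of "\<lambda>M. M$2$1"]
    by (simp add: mat2_mult_nth abc xyz field_simps)
  have parI: "\<exists>\<beta>. tlp B = \<beta> *\<^sub>R tlp A" if "x = \<beta> * a" "y = \<beta> * b" "z = \<beta> * c" for \<beta>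
    using that by (intro exI[of _ \<beta>]) (simp add: mat2_eq_iff abc xyz)
  have "a \<noteq> 0 \<or> b \<noteq> 0 \<or> c \<noteq> 0"
    using assms(2) by (auto simp: mat2_eq_iff abc)
  then consider "a \<noteq> 0" | "b \<noteq> 0" | "c \<noteq> 0" by blast
  then show ?thesis
  proof cases
    case 1
    then show ?thesis using 2 3 by (intro parI[of "x / a"]) (simp_all add: field_simps)
  next
    case 2
    then show ?thesis using 1 \<open>a * y = x * b\<close> by (intro parI[of "y / b"]) (simp_all add: field_simps)
  next
    case 3
    then show ?thesis using 1 \<open>a * z = x * c\<close> by (intro parI[of "z / c"]) (simp_all add: field_simps)
  qed
qed

lemma norm_commutator_le:
  assumes "det A = 1" "det B = 1"
  shows "norm (A ** B ** adj A ** adj B - mat 1)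
    \<le> 2 * norm (tlp A) * norm (tlp B) * norm A * norm B"
proof -
  have 1: "A ** B - B ** A = tlp A ** tlp B - tlp B ** tlp A"
    by (simp add: mat2_eq_iff mat2_mult_nth field_simps)
  have "(A ** B - B ** A) ** (adj A ** adj B) = A ** B ** adj A ** adj B - B ** A ** adj A ** adj B"
    by (simp add: mat2_eq_iff mat2_mult_nth algebra_simps)
  also have "B ** A ** adj A ** adj B = mat 1"
    using assms by (simp add: adj_right matrix_mul_assoc[symmetric] adj_right_mult)
  finally have "norm (A ** B ** adj A ** adj B - mat 1) = norm ((A ** B - B ** A) ** (adj A ** adj B))"
    by simp
  also have "\<dots> \<le> norm (A ** B - B ** A) * norm (adj A ** adj B)"
    by (rule norm_mat2_mult_le)
  also have "\<dots> \<le> (2 * norm (tlp A) * norm (tlp B)) * (norm A * norm B)"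
  proof (rule mult_mono)
    have "norm (A ** B - B ** A) \<le> norm (tlp A ** tlp B) + norm (tlp B ** tlp A)"
      unfolding 1 by (rule norm_triangle_ineq4)
    also have "\<dots> \<le> norm (tlp A) * norm (tlp B) + norm (tlp B) * norm (tlp A)"
      by (intro add_mono norm_mat2_mult_le)
    finally show "norm (A ** B - B ** A) \<le> 2 * norm (tlp A) * norm (tlp B)" by simp
    show "norm (adj A ** adj B) \<le> norm A * norm B"
      using norm_mat2_mult_le[of "adj A" "adj B"] by simp
  qed simp_all
  finally show ?thesis by (simp add: mult.assoc)
qed

section \<open>Nilpotent matrices and plane vectors\<close>

text \<open>
  Up to sign, the nonzero traceless nilpotent matrices are the \<open>nilp v\<close> with \<open>v \<noteq> 0\<close>;
  the kernel and the image of \<open>nilp v\<close> are spanned by \<open>v\<close>.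
\<close>

definition nilp :: "real^2 \<Rightarrow> real^2^2" where
  "nilp v = vector [vector [v$1 * v$2, - (v$1)\<^sup>2], vector [(v$2)\<^sup>2, - (v$1 * v$2)]]"

lemma nilp_nth [simp]:
  "nilp v$1$1 = v$1 * v$2" "nilp v$1$2 = - (v$1)\<^sup>2" "nilp v$2$1 = (v$2)\<^sup>2"
  "nilp v$2$2 = - (v$1 * v$2)"
  by (simp_all add: nilp_def)

lemma norm_nilp: "norm (nilp v) = (norm v)\<^sup>2"
proof -
  have "(norm (nilp v))\<^sup>2 = ((norm v)\<^sup>2)\<^sup>2"
    unfolding norm_mat2_sq norm_vec2_sq nilp_nth by algebra
  then show ?thesis by (rule power2_eq_imp_eq) simp_all
qed

lemma nilp_conj: "g ** nilp v ** adj g = nilp (g *v v)"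
  by (simp add: mat2_eq_iff mat2_mult_nth mat2_vec_nth power2_eq_square algebra_simps)

lemma traceless_nilpotent_eq_nilp:
  fixes Y :: "real^2^2"
  assumes "Y$2$2 = - Y$1$1" "det Y = 0"
  shows "\<exists>v. Y = nilp v \<or> Y = - nilp v"
proof -
  have d: "(Y$1$1)\<^sup>2 = - (Y$1$2 * Y$2$1)"
    using assms by (simp add: det_2 power2_eq_square)
  then have s: "Y$1$2 * Y$2$1 \<le> 0" by (smt (verit) zero_le_power2)
  \<comment> \<open>The entries off the diagonal have opposite signs, which decide the sign of \<open>nilp v\<close>.\<close>
  have key: "\<exists>v. Z = nilp v" if "Z$2$2 = - Z$1$1" "(Z$1$1)\<^sup>2 = - (Z$1$2 * Z$2$1)"
    "Z$1$2 \<le> 0" "0 \<le> Z$2$1" for Z :: "real^2^2"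
  proof -
    let ?p = "sqrt (- Z$1$2)" and ?q = "sqrt (Z$2$1)"
    have "(?p * ?q)\<^sup>2 = (Z$1$1)\<^sup>2" using that by (simp add: power_mult_distrib)
    then consider "Z$1$1 = ?p * ?q" | "Z$1$1 = - (?p * ?q)" by (auto simp: power2_eq_iff)
    then show ?thesis
    proof cases
      case 1
      then show ?thesis using that
        by (intro exI[of _ "vector [?p, ?q]"]) (simp add: mat2_eq_iff)
    next
      case 2
      then show ?thesis using that
        by (intro exI[of _ "vector [?p, - ?q]"]) (simp add: mat2_eq_iff)
    qed
  qed
  show ?thesis
  proof (cases "Y$1$2 \<le> 0 \<and> 0 \<le> Y$2$1")
    case True
    then show ?thesis using key[of Y] assms(1) d by auto
  next
    case False
    then have "0 \<le> Y$1$2 \<and> Y$2$1 \<le> 0"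
      using s by (auto simp: mult_le_0_iff)
    then have "\<exists>v. - Y = nilp v" using assms(1) d by (intro key) auto
    then show ?thesis by (metis minus_minus)
  qed
qed

lemma det_conj: "det g = 1 \<Longrightarrow> det (g ** A ** adj g) = det (A::real^2^2)"
  by (simp add: det_mul)

lemma conj_uminus: "g ** (- A) ** adj g = - (g ** A ** adj g)" for A :: "real^2^2"
  by (simp add: mat2_eq_iff mat2_mult_nth algebra_simps)

section \<open>The geodesic and horocycle one-parameter groups\<close>

lemma h_mat_nth [simp]:
  "h_mat s$1$1 = 1" "h_mat s$1$2 = 0" "h_mat s$2$1 = s" "h_mat s$2$2 = 1"
  by (simp_all add: h_mat_def)

lemma det_h_mat [simp]: "det (h_mat s) = 1"
  by (simp add: det_2)

lemma h_mat_add: "h_mat s ** h_mat t = h_mat (s + t)"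
  by (simp add: mat2_eq_iff mat2_mult_nth)

lemma h_mat_0 [simp]: "h_mat 0 = mat 1"
  by (simp add: mat2_eq_iff)

lemma h_mat_affine: "h_mat s = mat 1 + s *\<^sub>R (h_mat 1 - mat 1)"
  by (simp add: mat2_eq_iff)

lemma continuous_h_mat: "continuous_on S h_mat"
proof -
  define N where "N = h_mat 1 - mat 1"
  have eq: "h_mat = (\<lambda>s. mat 1 + s *\<^sub>R N)"
    unfolding N_def by (rule ext) (rule h_mat_affine)
  show ?thesis unfolding eq by (intro continuous_intros)
qed

lemma g_mat_nth [simp]:
  "g_mat t$1$1 = exp (t/2)" "g_mat t$1$2 = 0" "g_mat t$2$1 = 0" "g_mat t$2$2 = exp (- t/2)"
  by (simp_all add: g_mat_def)

lemma det_g_mat [simp]: "det (g_mat t) = 1"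
  by (simp add: det_2 exp_add[symmetric])

lemma norm_h_mat_sq: "(norm (h_mat s))\<^sup>2 = 2 + s\<^sup>2"
  by (simp add: norm_mat2_sq)

lemma norm_g_mat_sq: "(norm (g_mat t))\<^sup>2 = exp t + exp (- t)"
  unfolding norm_mat2_sq by (simp add: power2_eq_square exp_add[symmetric])

lemma two_ln_norm_g_mat_le: "2 * ln (norm (g_mat t)) \<le> \<bar>t\<bar> + ln 2"
proof -
  have 1: "1 \<le> norm (g_mat t)" by (rule norm_det1_ge1) simp
  then have "2 * ln (norm (g_mat t)) = ln ((norm (g_mat t))\<^sup>2)" by (simp add: ln_realpow)
  also have "\<dots> \<le> ln (2 * exp \<bar>t\<bar>)"
  proof (subst ln_le_cancel_iff)
    have "exp t \<le> exp \<bar>t\<bar>" "exp (- t) \<le> exp \<bar>t\<bar>" by simp_all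
    then show "(norm (g_mat t))\<^sup>2 \<le> 2 * exp \<bar>t\<bar>" unfolding norm_g_mat_sq by linarith
  qed (use 1 in auto)
  also have "\<dots> = \<bar>t\<bar> + ln 2" by (simp add: ln_mult)
  finally show ?thesis .
qed

lemma g_mat_conj_h_mat: "g_mat (- t) ** h_mat r ** g_mat t = h_mat (r * exp t)"
proof -
  have e: "exp (t/2) * exp (t/2) = exp t" by (simp add: exp_add[symmetric])
  have i: "exp (- (t/2)) * exp (t/2) = 1" by (simp add: exp_add[symmetric])
  have "exp (t/2) * r * exp (t/2) = r * exp t" unfolding e[symmetric] by simp
  then show ?thesis using i by (simp add: mat2_eq_iff mat2_mult_nth mult.commute)
qed

lemma h_mat_eq_conj:
  assumes "s \<noteq> 0"
  shows "h_mat s = g_mat (- ln \<bar>s\<bar>) ** h_mat (sgn s) ** g_mat (ln \<bar>s\<bar>)"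
  using assms by (simp add: g_mat_conj_h_mat sgn_mult_abs)

section \<open>Discrete subgroups\<close>

text \<open>
  The size of \<open>\<gamma>\<close> seen from \<open>g\<close>: the norm of the traceless part of \<open>g \<gamma> g\<^sup>-\<^sup>1\<close>. For
  \<open>\<gamma> \<in> \<Gamma>\<close> this is the size of an element of the stabiliser of the point \<open>g \<Gamma>\<close>.
\<close>

definition conj_size :: "real^2^2 \<Rightarrow> real^2^2 \<Rightarrow> real" where
  "conj_size g \<gamma> = norm (g ** tlp \<gamma> ** adj g)"

lemma conj_size_nonneg [simp]: "0 \<le> conj_size g \<gamma>"
  by (simp add: conj_size_def)

lemma conj_size_scaleR: "tlp \<gamma>' = \<beta> *\<^sub>R tlp \<gamma> \<Longrightarrow> conj_size g \<gamma>' = \<bar>\<beta>\<bar> * conj_size g \<gamma>"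
proof -
  assume a: "tlp \<gamma>' = \<beta> *\<^sub>R tlp \<gamma>"
  have "g ** (\<beta> *\<^sub>R tlp \<gamma>) ** adj g = \<beta> *\<^sub>R (g ** tlp \<gamma> ** adj g)"
    by (simp add: mat2_eq_iff mat2_mult_nth algebra_simps)
  then show ?thesis by (simp add: conj_size_def a)
qed

lemma conj_undo:
  assumes "det g = 1"
  shows "adj g ** (g ** A ** adj g) ** g = A"
  using assms by (simp add: matrix_mul_assoc[symmetric] adj_left adj_left_mult)

lemma norm_tlp_le_conj_size:
  assumes "det g = 1"
  shows "norm (tlp \<gamma>) \<le> (norm g)\<^sup>2 * conj_size g \<gamma>"
proof -
  have "norm (tlp \<gamma>) = norm (adj g ** (g ** tlp \<gamma> ** adj g) ** g)"
    using assms by (simp add: conj_undo)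
  also have "\<dots> \<le> norm (adj g ** (g ** tlp \<gamma> ** adj g)) * norm g"
    by (rule norm_mat2_mult_le)
  also have "\<dots> \<le> (norm g * conj_size g \<gamma>) * norm g"
    using norm_mat2_mult_le[of "adj g"] by (intro mult_right_mono) (auto simp: conj_size_def)
  finally show ?thesis by (simp add: power2_eq_square mult_ac)
qed

lemma conj_size_pos:
  assumes "det g = 1" "tlp \<gamma> \<noteq> 0"
  shows "0 < conj_size g \<gamma>"
proof (rule ccontr)
  assume "\<not> ?thesis"
  then have "conj_size g \<gamma> = 0" using conj_size_nonneg[of g \<gamma>] by linarith
  then show False using norm_tlp_le_conj_size[OF assms(1), of \<gamma>] assms(2) by simp
qed

lemma conj_size_mult:
  "conj_size (b ** g) \<gamma> = norm (b ** (g ** tlp \<gamma> ** adj g) ** adj b)"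
  by (simp add: conj_size_def adj_mult matrix_mul_assoc)

lemma conj_size_one [simp]: "conj_size (mat 1) \<gamma> = norm (tlp \<gamma>)"
proof -
  have "adj (mat 1) = mat 1" by (simp add: mat2_eq_iff)
  then show ?thesis by (simp add: conj_size_def)
qed

lemma conj_size_conj:
  assumes "det \<eta> = 1"
  shows "conj_size g (adj \<eta> ** \<gamma> ** \<eta>) = conj_size (g ** adj \<eta>) \<gamma>"
proof -
  have "tlp (adj \<eta> ** \<gamma> ** \<eta>) = adj \<eta> ** tlp \<gamma> ** \<eta>"
    using tlp_conj[of "adj \<eta>" \<gamma>] assms by simp
  then show ?thesis by (simp add: conj_size_def adj_mult matrix_mul_assoc)
qed

locale discrete_subgroup_SL2 =
  fixes \<Gamma> :: "(real^2^2) set"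
  assumes subgroup: "subgroup \<Gamma> SL2R" and discrete: "discrete \<Gamma>"
begin

lemma det1 [simp]: "\<gamma> \<in> \<Gamma> \<Longrightarrow> det \<gamma> = 1"
  using subgroup.subset[OF subgroup] by auto

lemma one_in [simp]: "mat 1 \<in> \<Gamma>"
  using subgroup.one_closed[OF subgroup] by simp

lemma mult_in [simp]: "\<gamma> \<in> \<Gamma> \<Longrightarrow> \<gamma>' \<in> \<Gamma> \<Longrightarrow> \<gamma> ** \<gamma>' \<in> \<Gamma>"
  using subgroup.m_closed[OF subgroup] by simp

lemma inv_SL2R: "det g = 1 \<Longrightarrow> inv\<^bsub>SL2R\<^esub> g = adj g"
  by (rule group.inv_equality[OF group_SL2R]) (simp_all add: adj_left)

lemma adj_in [simp]: "\<gamma> \<in> \<Gamma> \<Longrightarrow> adj \<gamma> \<in> \<Gamma>"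
  using subgroup.m_inv_closed[OF subgroup, of \<gamma>] by (simp add: inv_SL2R)

lemma mem_coset_iff: "a \<in> g <#\<^bsub>SL2R\<^esub> \<Gamma> \<longleftrightarrow> (\<exists>\<gamma>\<in>\<Gamma>. a = g ** \<gamma>)"
  by (auto simp: l_coset_def)

lemma finite_norm_le: "finite {\<gamma>\<in>\<Gamma>. norm \<gamma> \<le> R}"
proof -
  obtain r where r: "r > 0" "\<And>\<gamma>. \<gamma> \<in> \<Gamma> \<Longrightarrow> dist (mat 1) \<gamma> < r \<Longrightarrow> \<gamma> = mat 1"
    using discreteD[OF discrete one_in] by (auto elim: isolated_inE_dist)
  have "uniform_discrete {\<gamma>\<in>\<Gamma>. norm \<gamma> \<le> R}"
  proof (rule uniformI1[of "r / (1 + \<bar>R\<bar>)"])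
    fix \<gamma> \<gamma>' assume a: "\<gamma> \<in> {\<gamma>\<in>\<Gamma>. norm \<gamma> \<le> R}" "\<gamma>' \<in> {\<gamma>\<in>\<Gamma>. norm \<gamma> \<le> R}" "dist \<gamma> \<gamma>' < r / (1 + \<bar>R\<bar>)"
    have "mat 1 - adj \<gamma> ** \<gamma>' = adj \<gamma> ** (\<gamma> - \<gamma>')"
    proof -
      have "adj \<gamma> ** (\<gamma> - \<gamma>') = adj \<gamma> ** \<gamma> - adj \<gamma> ** \<gamma>'"
        by (simp add: mat2_eq_iff mat2_mult_nth algebra_simps)
      then show ?thesis using a by (simp add: adj_left)
    qed
    then have "dist (mat 1) (adj \<gamma> ** \<gamma>') \<le> norm \<gamma> * dist \<gamma> \<gamma>'"
      using norm_mat2_mult_le[of "adj \<gamma>" "\<gamma> - \<gamma>'"] by (simp add: dist_norm)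
    also have "\<dots> \<le> (1 + \<bar>R\<bar>) * dist \<gamma> \<gamma>'"
      using a by (intro mult_right_mono) auto
    also have "\<dots> < r" using a(3) by (simp add: pos_less_divide_eq mult.commute)
    finally have "adj \<gamma> ** \<gamma>' = mat 1" using r a by simp
    then show "\<gamma> = \<gamma>'" using a adj_right_mult[of \<gamma> \<gamma>'] by simp
  qed (use r in auto)
  moreover have "bounded {\<gamma>\<in>\<Gamma>. norm \<gamma> \<le> R}"
    by (auto intro: boundedI)
  ultimately show ?thesis by (simp add: uniform_discrete_finite_iff[symmetric])
qed

lemma countable: "countable \<Gamma>"
proof -
  have "\<Gamma> = (\<Union>n::nat. {\<gamma>\<in>\<Gamma>. norm \<gamma> \<le> real n})"
  proof (intro equalityI subsetI)
    fix \<gamma> assume "\<gamma> \<in> \<Gamma>"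
    moreover obtain n where "norm \<gamma> \<le> real n" using real_arch_simple by blast
    ultimately show "\<gamma> \<in> (\<Union>n::nat. {\<gamma>\<in>\<Gamma>. norm \<gamma> \<le> real n})" by blast
  qed auto
  also have "countable \<dots>" 
    using finite_norm_le by (intro countable_UN) (auto intro: countable_finite)
  finally show ?thesis .
qed

lemma closed: "closed \<Gamma>"
proof -
  have "x \<in> \<Gamma>" if "\<And>n. f n \<in> \<Gamma>" "f \<longlonglongrightarrow> x" for f :: "nat \<Rightarrow> real^2^2" and x
  proof -
    have "Bseq f" using that(2) by (intro convergent_imp_Bseq convergentI)
    then obtain K where "\<And>n. norm (f n) \<le> K" by (auto simp: Bseq_def)
    then have "\<And>n. f n \<in> {\<gamma>\<in>\<Gamma>. norm \<gamma> \<le> K}" using that by simp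
    moreover have "closed {\<gamma>\<in>\<Gamma>. norm \<gamma> \<le> K}"
      by (intro finite_imp_closed finite_norm_le)
    ultimately have "x \<in> {\<gamma>\<in>\<Gamma>. norm \<gamma> \<le> K}"
      using that(2) closed_sequentially by blast
    then show ?thesis by simp
  qed
  then show ?thesis by (auto simp: closed_sequential_limits)
qed

lemma finite_conj_size_le:
  assumes "det g = 1"
  shows "finite {\<gamma>\<in>\<Gamma>. conj_size g \<gamma> \<le> R}"
proof (rule finite_subset[OF _ finite_norm_le])
  show "{\<gamma>\<in>\<Gamma>. conj_size g \<gamma> \<le> R} \<subseteq> {\<gamma>\<in>\<Gamma>. norm \<gamma> \<le> sqrt (2 + 2 * ((norm g)\<^sup>2 * R)\<^sup>2)}"
  proof clarify
    fix \<gamma> assume \<gamma>: "\<gamma> \<in> \<Gamma>" "conj_size g \<gamma> \<le> R"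
    then have "norm (tlp \<gamma>) \<le> (norm g)\<^sup>2 * R"
      by (meson assms norm_tlp_le_conj_size mult_left_mono order_trans zero_le_power2)
    then have "(norm (tlp \<gamma>))\<^sup>2 \<le> ((norm g)\<^sup>2 * R)\<^sup>2" by (intro power_mono) auto
    then have "(norm \<gamma>)\<^sup>2 \<le> 2 + 2 * ((norm g)\<^sup>2 * R)\<^sup>2"
      using norm_det1_le_tlp[of \<gamma>] \<gamma> by simp
    then show "norm \<gamma> \<le> sqrt (2 + 2 * ((norm g)\<^sup>2 * R)\<^sup>2)"
      by (rule real_le_rsqrt)
  qed
qed

lemma obtain_minimal:
  assumes "det g = 1" "\<gamma>\<^sub>0 \<in> \<Gamma>" "tlp \<gamma>\<^sub>0 \<noteq> 0"
  obtains \<gamma> where "\<gamma> \<in> \<Gamma>" "tlp \<gamma> \<noteq> 0"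
    "\<And>\<gamma>'. \<gamma>' \<in> \<Gamma> \<Longrightarrow> tlp \<gamma>' \<noteq> 0 \<Longrightarrow> conj_size g \<gamma> \<le> conj_size g \<gamma>'"
proof -
  let ?S = "{\<gamma>\<in>\<Gamma>. conj_size g \<gamma> \<le> conj_size g \<gamma>\<^sub>0} \<inter> {\<gamma>. tlp \<gamma> \<noteq> 0}"
  have f: "finite ?S" using finite_conj_size_le[OF assms(1)] by blast
  have ne: "?S \<noteq> {}" using assms by auto
  define \<gamma> where "\<gamma> = arg_min_on (conj_size g) ?S"
  have "\<gamma> \<in> ?S" unfolding \<gamma>_def by (rule arg_min_if_finite[OF f ne])
  moreover have "conj_size g \<gamma> \<le> conj_size g \<gamma>'" if "\<gamma>' \<in> \<Gamma>" "tlp \<gamma>' \<noteq> 0" for \<gamma>'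
  proof (cases "\<gamma>' \<in> ?S")
    case True
    then show ?thesis unfolding \<gamma>_def using arg_min_if_finite(2)[OF f ne, of "conj_size g"] not_le by blast
  next
    case False
    then show ?thesis using that \<open>\<gamma> \<in> ?S\<close> by auto
  qed
  ultimately show ?thesis using that by blast
qed

text \<open>
  Zassenhaus' lemma. The commutator of a smallest element with another small element
  is smaller still, so that it is trivial: small elements commute with a smallest one,
  and so their traceless parts all lie on one line.
\<close>

lemma small_minimal_commute:
  assumes g: "det g = 1" and \<gamma>: "\<gamma> \<in> \<Gamma>" "tlp \<gamma> \<noteq> 0"
    and min: "\<And>\<gamma>'. \<gamma>' \<in> \<Gamma> \<Longrightarrow> tlp \<gamma>' \<noteq> 0 \<Longrightarrow> conj_size g \<gamma> \<le> conj_size g \<gamma>'"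
    and \<gamma>': "\<gamma>' \<in> \<Gamma>" "conj_size g \<gamma>' < 1/8" and small: "conj_size g \<gamma> < 1/8"
  shows "\<gamma> ** \<gamma>' = \<gamma>' ** \<gamma>"
proof -
  define A where "A = g ** \<gamma> ** adj g"
  define B where "B = g ** \<gamma>' ** adj g"
  define \<kappa> where "\<kappa> = \<gamma> ** \<gamma>' ** adj \<gamma> ** adj \<gamma>'"
  have tA: "norm (tlp A) = conj_size g \<gamma>" and tB: "norm (tlp B) = conj_size g \<gamma>'"
    using g by (simp_all add: A_def B_def conj_size_def tlp_conj)
  have dA: "det A = 1" and dB: "det B = 1"
    using g \<gamma> \<gamma>' by (simp_all add: A_def B_def det_conj)
  have \<kappa>: "g ** \<kappa> ** adj g = A ** B ** adj A ** adj B"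
    using g by (simp add: \<kappa>_def A_def B_def adj_mult matrix_mul_assoc[symmetric] adj_left_mult)
  have n2: "norm C \<le> 2" if "det C = 1" "norm (tlp C) < 1/8" for C
  proof -
    have "(norm (tlp C))\<^sup>2 \<le> (1/8)\<^sup>2" using that by (intro power_mono) auto
    then have "(norm C)\<^sup>2 \<le> 2\<^sup>2" using norm_det1_le_tlp[of C] that by (simp add: power2_eq_square)
    then show ?thesis by (rule power2_le_imp_le) simp
  qed
  have "norm (A ** B ** adj A ** adj B - mat 1) \<le> 2 * norm (tlp A) * norm (tlp B) * norm A * norm B"
    by (rule norm_commutator_le[OF dA dB])
  also have "\<dots> \<le> 2 * norm (tlp A) * norm (tlp B) * 2 * 2"
    using n2[of A] n2[of B] dA dB tA tB \<gamma>' small by (intro mult_mono mult_nonneg_nonneg) auto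
  finally have c: "norm (A ** B ** adj A ** adj B - mat 1) \<le> 8 * norm (tlp A) * norm (tlp B)"
    by simp
  have pos: "0 < norm (tlp A)" using conj_size_pos[OF g \<gamma>(2)] tA by simp
  have lt: "8 * norm (tlp A) * norm (tlp B) < norm (tlp A)"
    using pos \<gamma>'(2) tB by (simp add: mult.commute)
  have "conj_size g \<kappa> = norm (tlp (A ** B ** adj A ** adj B))"
    using g by (simp add: conj_size_def \<kappa>[symmetric] tlp_conj)
  also have "\<dots> \<le> norm (A ** B ** adj A ** adj B - mat 1)"
    using norm_tlp_le[of "A ** B ** adj A ** adj B" 1] by simp
  also have "\<dots> < conj_size g \<gamma>" using c lt tA by linarith
  finally have "tlp \<kappa> = 0" using min[of \<kappa>] \<gamma> \<gamma>' by (force simp: \<kappa>_def)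
  then consider "\<kappa> = mat 1" | "\<kappa> = - mat 1"
    using tlp_zero_imp[of \<kappa>] \<gamma> \<gamma>' by (auto simp: \<kappa>_def det_mul)
  then show ?thesis
  proof cases
    case 1
    then have "\<kappa> ** (\<gamma>' ** \<gamma>) = \<gamma>' ** \<gamma>" by simp
    moreover have "\<kappa> ** (\<gamma>' ** \<gamma>) = \<gamma> ** \<gamma>'"
      using \<gamma> \<gamma>' by (simp add: \<kappa>_def matrix_mul_assoc[symmetric] adj_left_mult adj_left)
    ultimately show ?thesis by simp
  next
    case 2
    \<comment> \<open>The commutator is too close to the identity to be its negative.\<close>
    have "g ** (- mat 1) ** adj g = - mat 1"
      using adj_right[OF g] by (simp add: mat2_eq_iff mat2_mult_nth)
    then have "A ** B ** adj A ** adj B - mat 1 = - (2 *\<^sub>R mat 1)"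
      unfolding \<kappa>[symmetric] 2 by (simp add: mat2_eq_iff)
    then have "norm (A ** B ** adj A ** adj B - mat 1) = 2 * norm (mat 1 :: real^2^2)"
      by simp
    moreover have "1 \<le> norm (mat 1 :: real^2^2)" by (rule norm_det1_ge1) simp
    ultimately show ?thesis using c lt tA small by simp
  qed
qed

lemma small_parallel:
  assumes g: "det g = 1" and \<gamma>: "\<gamma> \<in> \<Gamma>" "tlp \<gamma> \<noteq> 0" "conj_size g \<gamma> < 1/8"
    and \<gamma>': "\<gamma>' \<in> \<Gamma>" "conj_size g \<gamma>' < 1/8"
  shows "\<exists>\<beta>. tlp \<gamma>' = \<beta> *\<^sub>R tlp \<gamma>"
proof -
  obtain \<mu> where \<mu>: "\<mu> \<in> \<Gamma>" "tlp \<mu> \<noteq> 0"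
    "\<And>\<gamma>'. \<gamma>' \<in> \<Gamma> \<Longrightarrow> tlp \<gamma>' \<noteq> 0 \<Longrightarrow> conj_size g \<mu> \<le> conj_size g \<gamma>'"
    using obtain_minimal[OF g \<gamma>(1,2)] by metis
  have s: "conj_size g \<mu> < 1/8" using \<mu>(3)[OF \<gamma>(1,2)] \<gamma>(3) by simp
  obtain \<beta> where "tlp \<gamma> = \<beta> *\<^sub>R tlp \<mu>"
    using tlp_commute_parallel[OF small_minimal_commute[OF g \<mu> \<gamma>(1,3) s] \<mu>(2)] by auto
  moreover obtain \<beta>' where "tlp \<gamma>' = \<beta>' *\<^sub>R tlp \<mu>"
    using tlp_commute_parallel[OF small_minimal_commute[OF g \<mu> \<gamma>' s] \<mu>(2)] by auto
  ultimately have "tlp \<gamma>' = (\<beta>' / \<beta>) *\<^sub>R tlp \<gamma>" using \<gamma>(2) by auto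
  then show ?thesis by blast
qed

text \<open>
  The sizes of commuting elements are in the same ratio seen from \<open>g\<close> and from \<open>b g\<close>. So an
  element that is a smallest one seen from \<open>g\<close> is also one seen from \<open>b g\<close>, provided that it
  is small there.
\<close>

lemma minimal_persists:
  assumes g: "det g = 1" and b: "det b = 1" and \<gamma>: "\<gamma> \<in> \<Gamma>" "tlp \<gamma> \<noteq> 0"
    and min: "\<And>\<gamma>'. \<gamma>' \<in> \<Gamma> \<Longrightarrow> tlp \<gamma>' \<noteq> 0 \<Longrightarrow> conj_size g \<gamma> \<le> conj_size g \<gamma>'"
    and small: "conj_size (b ** g) \<gamma> < 1/8"
    and \<gamma>': "\<gamma>' \<in> \<Gamma>" "tlp \<gamma>' \<noteq> 0"
  shows "conj_size (b ** g) \<gamma> \<le> conj_size (b ** g) \<gamma>'"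
proof (rule ccontr)
  assume a: "\<not> ?thesis"
  have bg: "det (b ** g) = 1" using b g by (simp add: det_mul)
  obtain \<beta> where \<beta>: "tlp \<gamma>' = \<beta> *\<^sub>R tlp \<gamma>"
    using small_parallel[OF bg \<gamma> small \<gamma>'(1)] a small by auto
  have "conj_size g \<gamma> \<le> \<bar>\<beta>\<bar> * conj_size g \<gamma>"
    using min[OF \<gamma>'] conj_size_scaleR[OF \<beta>] by simp
  then have "1 \<le> \<bar>\<beta>\<bar>" using conj_size_pos[OF g \<gamma>(2)] by simp
  then have "conj_size (b ** g) \<gamma> \<le> \<bar>\<beta>\<bar> * conj_size (b ** g) \<gamma>"
    using conj_size_pos[OF bg \<gamma>(2)] by simp
  then show False using a conj_size_scaleR[OF \<beta>] by simp
qed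

end

section \<open>Haar measure and packing\<close>

lemma measurable_mat2_vec [measurable]: "(\<lambda>v::real^2. M *v v) \<in> borel_measurable borel"
  by (intro borel_measurable_continuous_onI linear_continuous_on bounded_linear.linear)
    (simp_all add: matrix_vector_mul_bounded_linear)

lemma lborel_distr_mat2_vec:
  fixes M :: "real^2^2"
  assumes M: "det M = 1"
  shows "distr lborel borel (\<lambda>v. M *v v) = lborel"
proof (rule lborel_eqI[symmetric])
  fix l u :: "real^2" assume le: "\<And>b. b \<in> Basis \<Longrightarrow> l \<bullet> b \<le> u \<bullet> b"
  let ?f = "\<lambda>v. M *v v" and ?f' = "\<lambda>v. adj M *v v"
  have vim: "?f -` box l u = ?f' ` box l u"
  proof (intro equalityI subsetI)
    fix v assume "v \<in> ?f -` box l u"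
    moreover have "v = ?f' (?f v)"
      using M by (simp add: matrix_vector_mul_assoc adj_left)
    ultimately show "v \<in> ?f' ` box l u" by blast
  next
    fix v assume "v \<in> ?f' ` box l u"
    then show "v \<in> ?f -` box l u"
      using M by (auto simp: matrix_vector_mul_assoc adj_right)
  qed
  have b: "?f -` box l u \<in> sets borel"
    using measurable_sets[OF measurable_mat2_vec, of "box l u" M] by simp
  have lm: "?f' ` box l u \<in> lmeasurable"
    by (intro measurable_linear_image matrix_vector_mul_linear lmeasurable_box)
  have "emeasure (distr lborel borel ?f) (box l u) = emeasure lborel (?f -` box l u)"
    by (subst emeasure_distr) auto
  also have "\<dots> = emeasure lebesgue (?f -` box l u)"
    using b by simp
  also have "\<dots> = ennreal (measure lebesgue (?f' ` box l u))"
    using lm unfolding vim by (simp add: emeasure_eq_measure2)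
  also have "measure lebesgue (?f' ` box l u) = measure lebesgue (box l u)"
    using measure_linear_image[OF matrix_vector_mul_linear[of "adj M"] lmeasurable_box[of l u]] M
    by (simp add: matrix_of_matrix_vector_mul)
  also have "\<dots> = (\<Prod>b\<in>Basis. (u - l) \<bullet> b)"
    using le by simp
  finally show "emeasure (distr lborel borel ?f) (box l u) = (\<Prod>b\<in>Basis. (u - l) \<bullet> b)" .
qed simp

text \<open>
  The matrix with given rows: \<open>\<real>\<^sup>2 \<times> \<real>\<^sup>2\<close> is identified with the space of matrices, so
  that right multiplication acts on each factor separately.
\<close>

definition of_rows :: "(real^2) \<times> (real^2) \<Rightarrow> real^2^2" where
  "of_rows p = vector [fst p, snd p]"

lemma of_rows_nth [simp]: "of_rows p$1 = fst p" "of_rows p$2 = snd p"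
  by (simp_all add: of_rows_def)

lemma measurable_of_rows [measurable]: "of_rows \<in> borel \<rightarrow>\<^sub>M borel"
proof (rule borel_measurable_continuous_onI)
  have "linear of_rows"
    by (rule linearI) (simp_all add: vec_eq_iff[where 'b=2] forall_2)
  then show "continuous_on UNIV of_rows"
    by (simp add: linear_continuous_on linear_conv_bounded_linear)
qed

lemma Basis_mat2: "(Basis :: (real^2^2) set) = (\<lambda>(i, j). axis i (axis j 1)) ` UNIV"
  by (auto simp: Basis_vec_def image_iff)

lemma Basis_vec2: "(Basis :: (real^2) set) = {axis 1 1, axis 2 1}"
  by (auto simp: Basis_vec_def UNIV_2)

lemma lborel_of_rows: "distr (lborel \<Otimes>\<^sub>M lborel) borel of_rows = lborel"
proof (rule lborel_eqI[symmetric])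
  fix l u :: "real^2^2" assume le: "\<And>b. b \<in> Basis \<Longrightarrow> l \<bullet> b \<le> u \<bullet> b"
  have le': "l$i$j \<le> u$i$j" for i j
    using le[of "axis i (axis j 1)"] by (simp add: inner_axis)
  have inj: "inj (\<lambda>(i, j). axis i (axis j (1::real)) :: real^2^2)"
    by (auto simp: inj_on_def axis_eq_axis)
  have "of_rows -` box l u = box (l$1) (u$1) \<times> box (l$2) (u$2)"
    by (auto simp: mem_box_cart box_def Basis_mat2 inner_axis forall_2 axis_in_Basis_iff Basis_vec_def)
  then have "emeasure (distr (lborel \<Otimes>\<^sub>M lborel) borel of_rows) (box l u)
      = emeasure (lborel \<Otimes>\<^sub>M lborel) (box (l$1) (u$1) \<times> box (l$2) (u$2))"
    by (subst emeasure_distr) (simp_all add: lborel_prod space_pair_measure)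
  also have "\<dots> = emeasure lborel (box (l$1) (u$1)) * emeasure lborel (box (l$2) (u$2))"
    by (intro lborel.emeasure_pair_measure_Times) auto
  also have "\<dots> = ennreal (\<Prod>i\<in>UNIV. \<Prod>j\<in>UNIV. u$i$j - l$i$j)"
    using le' by (simp add: emeasure_lborel_box_eq Basis_vec2 axis_eq_axis inner_axis ennreal_mult UNIV_2)
  also have "(\<Prod>i\<in>UNIV. \<Prod>j\<in>UNIV. u$i$j - l$i$j) = (\<Prod>b\<in>Basis. (u - l) \<bullet> b)"
    unfolding Basis_mat2 prod.reindex[OF inj] prod.cartesian_product
    by (auto simp: inner_axis intro!: prod.cong)
  finally show "emeasure (distr (lborel \<Otimes>\<^sub>M lborel) borel of_rows) (box l u) = ennreal (\<Prod>b\<in>Basis. (u - l) \<bullet> b)" .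
qed simp

lemma lborel_distr_mat2_mult:
  fixes g :: "real^2^2"
  assumes "det g = 1"
  shows "distr lborel borel (\<lambda>A::real^2^2. A ** g) = lborel"
proof -
  \<comment> \<open>The action on a row.\<close>
  define f where "f = (\<lambda>v. transpose g *v v)"
  have fd: "distr lborel borel f = lborel"
    unfolding f_def using assms by (intro lborel_distr_mat2_vec) simp
  have [measurable]: "f \<in> borel_measurable borel"
    unfolding f_def by (rule measurable_mat2_vec)
  have [measurable]: "(\<lambda>A::real^2^2. A ** g) \<in> borel_measurable borel"
    by (intro borel_measurable_continuous_onI continuous_intros)
  have rows: "of_rows p ** g = of_rows (f (fst p), f (snd p))" for p
    by (simp add: mat2_eq_iff mat2_mult_nth f_def mat2_vec_nth transpose_def mult.commute)
  have "distr lborel borel (\<lambda>A::real^2^2. A ** g)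
      = distr (distr (lborel \<Otimes>\<^sub>M lborel) borel of_rows) borel (\<lambda>A. A ** g)"
    by (simp add: lborel_of_rows)
  also have "\<dots> = distr (lborel \<Otimes>\<^sub>M lborel) borel (\<lambda>p. of_rows (f (fst p), f (snd p)))"
    by (subst distr_distr) (simp_all add: comp_def rows lborel_prod)
  also have "\<dots> = distr (distr (lborel \<Otimes>\<^sub>M lborel) (borel \<Otimes>\<^sub>M borel) (\<lambda>(x, y). (f x, f y))) borel of_rows"
    by (subst distr_distr) (simp_all add: comp_def case_prod_beta borel_prod)
  also have "distr (lborel \<Otimes>\<^sub>M lborel) (borel \<Otimes>\<^sub>M borel) (\<lambda>(x, y). (f x, f y))
      = distr lborel borel f \<Otimes>\<^sub>M distr lborel borel f"
    by (subst pair_measure_distr) (simp_all add: fd lborel.sigma_finite_measure_axioms)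
  finally show ?thesis by (simp add: fd lborel_of_rows)
qed


text \<open>
  The cone over \<open>B\<close>. For a Borel subset \<open>B\<close> of \<open>SL(2,\<real>)\<close>, its Lebesgue measure is the Haar
  measure of \<open>B\<close>.
\<close>

definition cone :: "(real^2^2) set \<Rightarrow> (real^2^2) set" where
  "cone B = {r *\<^sub>R A | r A. 0 < r \<and> r \<le> 1 \<and> A \<in> B}"

lemma mem_cone_iff:
  assumes "B \<subseteq> {A. det A = 1}"
  shows "C \<in> cone B \<longleftrightarrow> 0 < det C \<and> det C \<le> 1 \<and> (1 / sqrt (det C)) *\<^sub>R C \<in> B"
proof
  assume "C \<in> cone B"
  then obtain r A where C: "C = r *\<^sub>R A" "0 < r" "r \<le> 1" "A \<in> B" by (auto simp: cone_def)
  then have "det C = r\<^sup>2" using assms by (auto simp: det_scaleR_mat2)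
  then show "0 < det C \<and> det C \<le> 1 \<and> (1 / sqrt (det C)) *\<^sub>R C \<in> B"
    using C by (simp add: power_le_one)
next
  assume a: "0 < det C \<and> det C \<le> 1 \<and> (1 / sqrt (det C)) *\<^sub>R C \<in> B"
  then have "C = sqrt (det C) *\<^sub>R ((1 / sqrt (det C)) *\<^sub>R C)" "0 < sqrt (det C)" "sqrt (det C) \<le> 1"
    by auto
  then show "C \<in> cone B" unfolding cone_def using a by blast
qed

lemma continuous_det_mat2: "continuous_on S (det :: real^2^2 \<Rightarrow> real)"
  by (simp add: det_2 [abs_def] continuous_intros)

lemma measurable_det_mat2 [measurable]: "(det :: real^2^2 \<Rightarrow> real) \<in> borel_measurable borel"
  by (intro borel_measurable_continuous_onI continuous_det_mat2)

lemma cone_borel: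
  assumes [measurable]: "B \<in> sets borel" and B: "B \<subseteq> {A. det A = 1}"
  shows "cone B \<in> sets borel"
proof -
  have "cone B = {C \<in> space borel. 0 < det C \<and> det C \<le> 1 \<and> (1 / sqrt (det C)) *\<^sub>R C \<in> B}"
    using mem_cone_iff[OF B] by auto
  also have "\<dots> \<in> sets borel" by measurable
  finally show ?thesis .
qed

lemma image_right_mult:
  assumes "det g = 1"
  shows "(\<lambda>A. A ** g) ` B = (\<lambda>A::real^2^2. A ** adj g) -` B"
proof (intro equalityI subsetI)
  fix A assume "A \<in> (\<lambda>A. A ** adj g) -` B"
  moreover have "A = (A ** adj g) ** g"
    using assms by (simp add: matrix_mul_assoc[symmetric] adj_left)
  ultimately show "A \<in> (\<lambda>A. A ** g) ` B" by blast
qed (use assms in \<open>auto simp: matrix_mul_assoc[symmetric] adj_right\<close>)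

lemma measurable_right_mult:
  "(\<lambda>A::real^2^2. A ** (g::real^2^2)) \<in> borel_measurable borel"
  by (intro borel_measurable_continuous_onI continuous_intros)

lemma borel_image_right_mult:
  assumes "det g = 1" "B \<in> sets borel"
  shows "(\<lambda>A::real^2^2. A ** g) ` B \<in> sets borel"
proof -
  have "(\<lambda>A::real^2^2. A ** adj g) -` B \<inter> space borel \<in> sets borel"
    by (rule measurable_sets[OF measurable_right_mult]) (rule assms(2))
  then show ?thesis by (simp only: image_right_mult[OF assms(1)] space_borel Int_UNIV_right)
qed

lemma haar_right_invariant:
  assumes g: "det g = 1" and B: "B \<in> sets borel" "B \<subseteq> {A. det A = 1}"
  shows "emeasure haar_SL2R ((\<lambda>A. A ** g) ` B) = emeasure haar_SL2R B"
proof -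
  have sub: "(\<lambda>A. A ** g) ` B \<subseteq> {A. det A = 1}"
    using g B by (auto simp: det_mul)
  have "cone ((\<lambda>A. A ** g) ` B) = (\<lambda>A. A ** adj g) -` cone B"
  proof -
    have "(r *\<^sub>R A) ** g = r *\<^sub>R (A ** g)" for r and A :: "real^2^2"
      by (simp add: mat2_eq_iff mat2_mult_nth algebra_simps)
    then have "cone ((\<lambda>A. A ** g) ` B) = (\<lambda>A. A ** g) ` cone B"
      unfolding cone_def by (auto simp: image_iff) metis+
    then show ?thesis by (simp add: image_right_mult[OF g])
  qed
  then have "emeasure lborel (cone ((\<lambda>A. A ** g) ` B))
      = emeasure (distr lborel borel (\<lambda>A. A ** adj g)) (cone B)"
    using cone_borel[OF B] measurable_right_mult[of "adj g"] by (simp add: emeasure_distr)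
  also have "\<dots> = emeasure lborel (cone B)"
    using g by (subst lborel_distr_mat2_mult) simp_all
  finally have "emeasure lborel (cone ((\<lambda>A. A ** g) ` B)) = emeasure lborel (cone B)" .
  moreover have "carrier SL2R = {A. det A = 1}" by auto
  ultimately show ?thesis
    using emeasure_haar_SL2R[of B] emeasure_haar_SL2R[of "(\<lambda>A. A ** g) ` B"]
      B sub borel_image_right_mult[OF g B(1)]
    by (simp add: cone_def)
qed

text \<open>The neighbourhoods of the identity whose translates are packed into the quotient.\<close>

definition unit_nbhd :: "real \<Rightarrow> (real^2^2) set" where
  "unit_nbhd r = {A. det A = 1 \<and> norm (A - mat 1) < r}"

lemma unit_nbhd_borel: "unit_nbhd r \<in> sets borel"
proof -
  have "unit_nbhd r = {A \<in> space borel. det A = 1 \<and> norm (A - mat 1) < r}"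
    by (simp add: unit_nbhd_def)
  also have "\<dots> \<in> sets borel" by measurable
  finally show ?thesis .
qed

lemma haar_unit_nbhd_pos:
  assumes "r > 0"
  shows "emeasure haar_SL2R (unit_nbhd r) > 0"
proof -
  define W where "W = {A::real^2^2. 0 < det A} \<inter> {A. det A < 1} \<inter>
    {A. norm (A - sqrt (det A) *\<^sub>R mat 1) < r * sqrt (det A)}"
  have "open W" unfolding W_def
    by (intro open_Int open_Collect_less continuous_intros continuous_det_mat2)
  have sub: "W \<subseteq> cone (unit_nbhd r)"
  proof
    fix A assume A: "A \<in> W"
    define s where "s = sqrt (det A)"
    have s: "0 < s" "s\<^sup>2 = det A" using A by (simp_all add: s_def W_def)
    have "(1 / s) *\<^sub>R A - mat 1 = (1 / s) *\<^sub>R (A - s *\<^sub>R mat 1)"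
      using s by (simp add: scaleR_right_diff_distrib)
    then have "norm ((1 / s) *\<^sub>R A - mat 1) = norm (A - s *\<^sub>R mat 1) / s"
      using s by simp
    also have "\<dots> < r"
      using A s by (simp add: W_def s_def pos_divide_less_eq)
    finally have "norm ((1 / s) *\<^sub>R A - mat 1) < r" .
    moreover have "det ((1 / s) *\<^sub>R A) = 1"
      using s by (simp add: det_scaleR_mat2 power_one_over s(2)[symmetric])
    ultimately show "A \<in> cone (unit_nbhd r)"
      using A by (subst mem_cone_iff) (auto simp: unit_nbhd_def W_def s_def)
  qed
  have "(1/2) *\<^sub>R mat 1 \<in> W"
    using assms by (simp add: W_def det_scaleR_mat2 power2_eq_square real_sqrt_divide)
  then have "\<not> negligible W" using open_not_negligible[OF \<open>open W\<close>] by blast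
  moreover have "W \<in> sets borel" using \<open>open W\<close> by simp
  ultimately have "emeasure lborel W \<noteq> 0"
    by (auto simp: negligible_iff_null_sets null_sets_def)
  then have "0 < emeasure lborel W" by (simp add: zero_less_iff_neq_zero)
  also have "\<dots> \<le> emeasure lborel (cone (unit_nbhd r))"
    using sub by (intro emeasure_mono) (auto intro!: cone_borel unit_nbhd_borel simp: unit_nbhd_def)
  also have "\<dots> = emeasure haar_SL2R (unit_nbhd r)"
    by (subst emeasure_haar_SL2R) (auto simp: cone_def unit_nbhd_borel unit_nbhd_def)
  finally show ?thesis .
qed

lemma sets_haar [simp]: "sets haar_SL2R = sets borel"
  by (simp add: haar_SL2R_def)

text \<open>\<open>F\<close> is a fundamental domain that witnesses the finiteness of the volume.\<close>

locale finite_volume_SL2 = discrete_subgroup_SL2 +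
  fixes F
  assumes fundamental: "fundamental_domain \<Gamma> F"
    and finite_volume: "emeasure haar_SL2R F < \<infinity>"
begin

text \<open>
  A set that meets no coset twice has no more volume than a fundamental domain: its parts in
  the translates of \<open>F\<close> can be moved back into \<open>F\<close>, where they remain disjoint.
\<close>

lemma packing_bound:
  assumes E: "E \<in> sets borel" "E \<subseteq> {A. det A = 1}"
    and inj: "\<And>a \<gamma>. a \<in> E \<Longrightarrow> \<gamma> \<in> \<Gamma> \<Longrightarrow> a ** \<gamma> \<in> E \<Longrightarrow> \<gamma> = mat 1"
  shows "emeasure haar_SL2R E \<le> emeasure haar_SL2R F"
proof -
  have F: "F \<in> sets borel" "F \<subseteq> {A. det A = 1}"
    and F1: "\<And>g. det g = 1 \<Longrightarrow> \<exists>!a. a \<in> F \<and> (\<exists>\<gamma>\<in>\<Gamma>. a = g ** \<gamma>)"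
  proof -
    show "F \<in> sets borel" "F \<subseteq> {A. det A = 1}"
      using fundamental by (auto simp: fundamental_domain_def)
    fix g :: "real^2^2" assume "det g = 1"
    then have "g <#\<^bsub>SL2R\<^esub> \<Gamma> \<in> lcosets\<^bsub>SL2R\<^esub> \<Gamma>" by (auto simp: LCOSETS_def)
    then have "\<exists>!a. a \<in> F \<inter> (g <#\<^bsub>SL2R\<^esub> \<Gamma>)"
      using fundamental unfolding fundamental_domain_def by blast
    then show "\<exists>!a. a \<in> F \<and> (\<exists>\<gamma>\<in>\<Gamma>. a = g ** \<gamma>)"
      by (simp only: Int_iff mem_coset_iff)
  qed
  \<comment> \<open>The translate by \<open>\<gamma>\<^sup>-\<^sup>1\<close> of the part of \<open>E\<close> in \<open>F \<gamma>\<close>, a subset of \<open>F\<close>.\<close>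
  define X where "X \<gamma> = F \<inter> (\<lambda>A. A ** \<gamma>) -` E" for \<gamma>
  have X: "X \<gamma> \<in> sets borel" "X \<gamma> \<subseteq> {A. det A = 1}" for \<gamma>
    using F measurable_sets[OF measurable_right_mult E(1)] unfolding X_def by auto
  have disX: "disjoint_family_on X \<Gamma>"
  proof (unfold disjoint_family_on_def, intro ballI impI, rule ccontr)
    fix \<gamma> \<gamma>' assume a: "\<gamma> \<in> \<Gamma>" "\<gamma>' \<in> \<Gamma>" "\<gamma> \<noteq> \<gamma>'" "X \<gamma> \<inter> X \<gamma>' \<noteq> {}"
    then obtain b where b: "b ** \<gamma> \<in> E" "b ** \<gamma>' \<in> E" by (auto simp: X_def)
    have "b ** \<gamma>' = (b ** \<gamma>) ** (adj \<gamma> ** \<gamma>')"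
      using a by (simp add: matrix_mul_assoc[symmetric] adj_right_mult)
    then have "adj \<gamma> ** \<gamma>' = mat 1" using inj[of "b ** \<gamma>" "adj \<gamma> ** \<gamma>'"] a b by auto
    then show False using a adj_right_mult[of \<gamma> \<gamma>'] by simp
  qed
  define Y where "Y \<gamma> = (\<lambda>A. A ** \<gamma>) ` X \<gamma>" for \<gamma>
  have disY: "disjoint_family_on Y \<Gamma>"
  proof (unfold disjoint_family_on_def, intro ballI impI, rule ccontr)
    fix \<gamma> \<gamma>' assume a: "\<gamma> \<in> \<Gamma>" "\<gamma>' \<in> \<Gamma>" "\<gamma> \<noteq> \<gamma>'" "Y \<gamma> \<inter> Y \<gamma>' \<noteq> {}"
    then obtain b b' where b: "b \<in> F" "b' \<in> F" "b ** \<gamma> = b' ** \<gamma>'" by (auto simp: X_def Y_def)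
    have db: "det b = 1" "det b' = 1" using b F by auto
    have "b' = (b' ** \<gamma>') ** adj \<gamma>'"
      using a by (simp add: matrix_mul_assoc[symmetric] adj_right)
    then have "b' = b ** (\<gamma> ** adj \<gamma>')" by (simp add: b(3)[symmetric] matrix_mul_assoc)
    then have "\<exists>\<gamma>\<in>\<Gamma>. b' = b ** \<gamma>" "\<exists>\<gamma>\<in>\<Gamma>. b = b ** \<gamma>"
      using a by (auto intro: bexI[of _ "mat 1"])
    then have "b = b'" using F1[OF db(1)] b by blast
    then have "\<gamma> = \<gamma>'"
      using b(3) adj_left_mult[OF db(1), of \<gamma>] adj_left_mult[OF db(1), of \<gamma>'] by simp
    then show False using a by simp
  qed
  have cover: "E = \<Union> (Y ` \<Gamma>)"
  proof (intro equalityI subsetI)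
    fix a assume a: "a \<in> E"
    then have "det a = 1" using E by auto
    then obtain \<gamma> where \<gamma>: "\<gamma> \<in> \<Gamma>" "a ** \<gamma> \<in> F" using F1 by blast
    have "a = (a ** \<gamma>) ** adj \<gamma>"
      using \<gamma> by (simp add: matrix_mul_assoc[symmetric] adj_right)
    then have "a \<in> Y (adj \<gamma>)" using a \<gamma>(2) unfolding X_def Y_def by auto
    then show "a \<in> \<Union> (Y ` \<Gamma>)" using adj_in[OF \<gamma>(1)] by (rule UN_I[rotated])
  qed (auto simp: X_def Y_def)
  have "emeasure haar_SL2R E = (\<integral>\<^sup>+\<gamma>. emeasure haar_SL2R (Y \<gamma>) \<partial>count_space \<Gamma>)"
    unfolding cover using X
    by (intro emeasure_UN_countable countable disY) (auto simp: Y_def intro!: borel_image_right_mult)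
  also have "\<dots> = (\<integral>\<^sup>+\<gamma>. emeasure haar_SL2R (X \<gamma>) \<partial>count_space \<Gamma>)"
    unfolding Y_def by (intro nn_integral_cong haar_right_invariant X) auto
  also have "\<dots> = emeasure haar_SL2R (\<Union> (X ` \<Gamma>))"
    using X by (intro emeasure_UN_countable[symmetric] countable disX) auto
  also have "\<dots> \<le> emeasure haar_SL2R F"
    using F by (intro emeasure_mono) (auto simp: X_def)
  finally show ?thesis .
qed

text \<open>
  The thick part is bounded: each of its points is the centre of an embedded copy of a
  fixed neighbourhood of the identity, and only finitely many disjoint copies fit into a
  space of finite volume. A maximal family of disjoint copies then comes close to every
  other point of the thick part.
\<close>

lemma thick_bounded:
  assumes "\<epsilon> > 0"
  obtains R where "R > 0"
    "\<And>g. det g = 1 \<Longrightarrow> (\<And>\<gamma>. \<gamma> \<in> \<Gamma> \<Longrightarrow> tlp \<gamma> \<noteq> 0 \<Longrightarrow> \<epsilon> \<le> conj_size g \<gamma>) \<Longrightarrow> \<exists>\<gamma>\<in>\<Gamma>. norm (g ** \<gamma>) \<le> R"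
proof -
  define r where "r = min \<epsilon> 1 / 7"
  have r: "r > 0" "r \<le> 1/7" "7 * r \<le> \<epsilon>" using assms by (simp_all add: r_def)
  define V where "V = unit_nbhd r"
  have V: "V \<in> sets borel" by (simp add: V_def unit_nbhd_borel)
  have Vd: "det b = 1" "norm (b - mat 1) < r" "norm b \<le> 3" if "b \<in> V" for b
  proof -
    show b: "det b = 1" "norm (b - mat 1) < r" using that by (auto simp: V_def unit_nbhd_def)
    have "(norm (mat 1 :: real^2^2))\<^sup>2 = 2" by (simp add: norm_mat2_sq)
    then have "norm (mat 1 :: real^2^2) \<le> 2"
      using power2_le_imp_le[of "norm (mat 1 :: real^2^2)" 2] by simp
    moreover have "norm b \<le> norm (b - mat 1) + norm (mat 1 :: real^2^2)"
      by (metis diff_add_cancel norm_triangle_ineq)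
    ultimately show "norm b \<le> 3" using b(2) r by linarith
  qed
  define thick where
    "thick g \<longleftrightarrow> det g = 1 \<and> (\<forall>\<gamma>\<in>\<Gamma>. tlp \<gamma> \<noteq> 0 \<longrightarrow> \<epsilon> \<le> conj_size g \<gamma>)" for g
  have embedded: "\<gamma> = mat 1"
    if g: "thick g" and b: "b \<in> V" "b' \<in> V" and \<gamma>: "\<gamma> \<in> \<Gamma>" and eq: "b ** g ** \<gamma> = b' ** g" for g b b' \<gamma>
  proof -
    have dg: "det g = 1" using g by (simp add: thick_def)
    define C where "C = g ** \<gamma> ** adj g"
    have "C = adj b ** (b ** g ** \<gamma>) ** adj g"
      using Vd(1)[OF b(1)] by (simp add: C_def matrix_mul_assoc[symmetric] adj_left_mult)
    also have "\<dots> = adj b ** (b' ** g) ** adj g" by (simp only: eq)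
    also have "\<dots> = adj b ** b'"
      using dg by (simp add: matrix_mul_assoc[symmetric] adj_right)
    finally have C: "C = adj b ** b'" .
    have "C - mat 1 = adj b ** (b' - b)"
    proof -
      have "adj b ** (b' - b) = adj b ** b' - adj b ** b"
        by (simp add: mat2_eq_iff mat2_mult_nth algebra_simps)
      then show ?thesis using Vd(1)[OF b(1)] by (simp add: C adj_left)
    qed
    then have "norm (C - mat 1) \<le> norm b * norm (b' - b)"
      using norm_mat2_mult_le[of "adj b" "b' - b"] by simp
    also have "\<dots> \<le> 3 * (2 * r)"
    proof (intro mult_mono Vd(3)[OF b(1)])
      have "norm (b' - b) = norm ((b' - mat 1) - (b - mat 1))" by simp
      also have "\<dots> \<le> norm (b' - mat 1) + norm (b - mat 1)" by (rule norm_triangle_ineq4)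
      finally show "norm (b' - b) \<le> 2 * r" using Vd(2)[OF b(1)] Vd(2)[OF b(2)] by linarith
    qed auto
    finally have small: "norm (C - mat 1) < 7 * r" using r by simp
    have "conj_size g \<gamma> = norm (tlp C)" using dg by (simp add: C_def tlp_conj conj_size_def)
    also have "\<dots> < \<epsilon>" using norm_tlp_le[of C 1] small r by simp
    finally have "tlp \<gamma> = 0" using g \<gamma> by (force simp: thick_def)
    then consider "\<gamma> = mat 1" | "\<gamma> = - mat 1"
      using tlp_zero_imp[of \<gamma>] \<gamma> by auto
    then show ?thesis
    proof cases
      case 2
      have "g ** (- mat 1) ** adj g = - (g ** adj g)"
        by (simp add: mat2_eq_iff mat2_mult_nth)
      then have "C - mat 1 = - (2 *\<^sub>R mat 1)"
        using dg unfolding C_def 2 by (simp add: mat2_eq_iff adj_right)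
      then have "norm (C - mat 1) = 2 * norm (mat 1 :: real^2^2)" by simp
      moreover have "1 \<le> norm (mat 1 :: real^2^2)" by (rule norm_det1_ge1) simp
      ultimately show ?thesis using small r by simp
    qed
  qed
  define separated where "separated S \<longleftrightarrow> finite S \<and> (\<forall>g\<in>S. thick g) \<and>
    (\<forall>g\<in>S. \<forall>g'\<in>S. \<forall>\<gamma>\<in>\<Gamma>. \<forall>b\<in>V. \<forall>b'\<in>V. b ** g ** \<gamma> = b' ** g' \<longrightarrow> g = g')" for S
  have packing: "of_nat (card S) * emeasure haar_SL2R V \<le> emeasure haar_SL2R F" if S: "separated S" for S
  proof -
    define U where "U g = (\<lambda>A. A ** g) ` V" for g :: "real^2^2"
    have dS: "det g = 1" if "g \<in> S" for g using S that by (auto simp: separated_def thick_def)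
    have U: "U g \<in> sets borel" if "g \<in> S" for g
      unfolding U_def using borel_image_right_mult[OF dS[OF that] V] .
    have dis: "disjoint_family_on U S"
    proof (unfold disjoint_family_on_def, intro ballI impI, rule ccontr)
      fix g g' assume a: "g \<in> S" "g' \<in> S" "g \<noteq> g'" "U g \<inter> U g' \<noteq> {}"
      then obtain b b' where "b \<in> V" "b' \<in> V" "b ** g ** mat 1 = b' ** g'" by (auto simp: U_def)
      then show False using S a one_in unfolding separated_def by blast
    qed
    have "emeasure haar_SL2R (U g) = emeasure haar_SL2R V" if "g \<in> S" for g
      unfolding U_def by (intro haar_right_invariant dS that V) (use Vd in auto)
    then have "of_nat (card S) * emeasure haar_SL2R V = (\<Sum>g\<in>S. emeasure haar_SL2R (U g))"
      by simp
    also have "\<dots> = emeasure haar_SL2R (\<Union> (U ` S))"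
      using S U dis by (intro sum_emeasure) (auto simp: separated_def)
    also have "\<dots> \<le> emeasure haar_SL2R F"
    proof (rule packing_bound)
      show "\<Union> (U ` S) \<in> sets borel"
        using S U by (intro sets.finite_UN) (auto simp: separated_def)
      show "\<Union> (U ` S) \<subseteq> {A. det A = 1}"
        using dS Vd by (auto simp: U_def det_mul)
      fix a \<gamma> assume a: "a \<in> \<Union> (U ` S)" "\<gamma> \<in> \<Gamma>" "a ** \<gamma> \<in> \<Union> (U ` S)"
      then obtain g g' b b' where *: "g \<in> S" "g' \<in> S" "b \<in> V" "b' \<in> V" "b ** g ** \<gamma> = b' ** g'"
        unfolding U_def by blast
      then have "g = g'" using S a(2) unfolding separated_def by blast
      then show "\<gamma> = mat 1" using embedded[of g b b' \<gamma>] S * a(2) by (auto simp: separated_def)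
    qed
    finally show ?thesis .
  qed
  obtain e where e: "0 < e" "e < emeasure haar_SL2R V"
    using dense[OF haar_unit_nbhd_pos[OF r(1)]] by (auto simp: V_def)
  have "e < \<infinity>" by (rule order_less_le_trans[OF e(2)]) simp
  then obtain c where "e = ennreal c" "0 \<le> c" by (cases e) auto
  with e have c: "0 < c" "ennreal c < emeasure haar_SL2R V" by (auto simp: order_less_le)
  obtain w where w: "emeasure haar_SL2R F = ennreal w" "0 \<le> w"
    using finite_volume by (cases "emeasure haar_SL2R F") auto
  have card_bound: "card S \<le> nat \<lceil>w / c\<rceil>" if "separated S" for S
  proof -
    have "ennreal (real (card S) * c) = of_nat (card S) * ennreal c"
      using c by (simp add: ennreal_mult ennreal_of_nat_eq_real_of_nat)
    also have "\<dots> \<le> of_nat (card S) * emeasure haar_SL2R V"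
      using c by (intro mult_left_mono) auto
    also have "\<dots> \<le> ennreal w" using packing[OF that] w by simp
    finally have "real (card S) * c \<le> w" using w by simp
    then have "real (card S) \<le> w / c" using c by (simp add: pos_le_divide_eq)
    then show ?thesis by linarith
  qed
  have "separated {}" by (simp add: separated_def)
  then obtain S where S: "separated S" and max: "\<And>T. separated T \<Longrightarrow> card T \<le> card S"
    using ex_has_greatest_nat[of separated "{}" card "Suc (nat \<lceil>w / c\<rceil>)"] card_bound
    by (auto simp: less_Suc_eq_le)
  have fin: "finite S" using S by (simp add: separated_def)
  define M where "M = 1 + (\<Sum>g\<in>S. norm g)"
  have M: "norm g \<le> M" if "g \<in> S" for g
    using member_le_sum[OF that, of norm] fin by (simp add: M_def)
  have M1: "1 \<le> M" by (simp add: M_def sum_nonneg)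
  have near: "norm (adj b ** b' ** g) \<le> 9 * M" if "b \<in> V" "b' \<in> V" "g \<in> S" for b b' g
  proof -
    have "norm (adj b ** b' ** g) \<le> norm (adj b ** b') * norm g" by (rule norm_mat2_mult_le)
    also have "\<dots> \<le> (norm b * norm b') * norm g"
      using norm_mat2_mult_le[of "adj b" b'] by (intro mult_right_mono) auto
    also have "\<dots> \<le> (3 * 3) * M"
      using that M1 by (intro mult_mono Vd(3) M) auto
    finally show ?thesis by simp
  qed
  show ?thesis
  proof (rule that[of "9 * M"])
    show "9 * M > 0" using M1 by simp
    fix g assume dg: "det g = 1" and "\<And>\<gamma>. \<gamma> \<in> \<Gamma> \<Longrightarrow> tlp \<gamma> \<noteq> 0 \<Longrightarrow> \<epsilon> \<le> conj_size g \<gamma>"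
    then have g: "thick g" by (simp add: thick_def)
    show "\<exists>\<gamma>\<in>\<Gamma>. norm (g ** \<gamma>) \<le> 9 * M"
    proof (cases "g \<in> S")
      case True
      then show ?thesis using M[OF True] M1 by (intro bexI[of _ "mat 1"]) auto
    next
      case False
      then have "\<not> separated (insert g S)" using max[of "insert g S"] fin by auto
      then obtain g1 g2 \<gamma> b b' where *: "g1 \<in> insert g S" "g2 \<in> insert g S" "\<gamma> \<in> \<Gamma>" "b \<in> V" "b' \<in> V"
        "b ** g1 ** \<gamma> = b' ** g2" "g1 \<noteq> g2"
        using fin g S unfolding separated_def by (metis (no_types, lifting) finite_insert insert_iff)
      consider "g1 = g" "g2 \<in> S" | "g2 = g" "g1 \<in> S"
        using * S unfolding separated_def by blast
      then show ?thesis
      proof cases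
        case 1
        have "g ** \<gamma> = adj b ** (b ** g1 ** \<gamma>)"
          using 1 Vd(1)[OF *(4)] by (simp add: matrix_mul_assoc[symmetric] adj_left_mult)
        also have "\<dots> = adj b ** (b' ** g2)" by (simp only: *(6))
        also have "\<dots> = adj b ** b' ** g2" by (simp add: matrix_mul_assoc)
        finally show ?thesis using near[OF *(4,5) 1(2)] *(3) by (intro bexI[of _ \<gamma>]) simp_all
      next
        case 2
        have "g ** adj \<gamma> = adj b' ** (b' ** g2) ** adj \<gamma>"
          using 2 Vd(1)[OF *(5)] by (simp add: adj_left_mult)
        also have "\<dots> = adj b' ** (b ** g1 ** \<gamma>) ** adj \<gamma>" by (simp only: *(6))
        also have "\<dots> = adj b' ** b ** g1"
          using *(3) by (simp add: matrix_mul_assoc[symmetric] adj_right)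
        finally show ?thesis using near[OF *(5,4) 2(2)] *(3) by (intro bexI[of _ "adj \<gamma>"]) simp_all
      qed
    qed
  qed
qed

end

section \<open>Parabolic vectors\<close>

lemma path_conj_norm_attained:
  fixes b :: "real \<Rightarrow> real^2^2"
  assumes "continuous_on UNIV b" "norm (b 0 ** Y ** adj (b 0)) \<le> e" "e \<le> norm (b s ** Y ** adj (b s))"
  shows "\<exists>t. norm (b t ** Y ** adj (b t)) = e"
proof -
  let ?f = "\<lambda>t. norm (b t ** Y ** adj (b t))"
  have "continuous_on UNIV (adj \<circ> b)"
    using linear_adj by (intro continuous_on_compose assms(1) linear_continuous_on)
      (simp add: linear_conv_bounded_linear)
  then have "continuous_on UNIV ?f"
    using assms(1) unfolding comp_def
    by (intro continuous_on_norm continuous_on_mat2_mult continuous_on_const)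
  then have "connected (range ?f)"
    by (intro connected_continuous_image) auto
  then have "{?f 0..?f s} \<subseteq> range ?f"
    by (intro connected_contains_Icc) auto
  then show ?thesis using assms(2,3) by (auto simp: image_iff)
qed

text \<open>Conjugation can bring any nonzero traceless matrix to any larger norm.\<close>

lemma conj_norm_attained:
  fixes Y :: "real^2^2"
  assumes tr: "Y$2$2 = - Y$1$1" and "Y \<noteq> 0" "norm Y \<le> e"
  obtains b where "det b = 1" "norm (b ** Y ** adj b) = e"
proof (cases "Y$1$1 = 0 \<and> Y$1$2 = 0")
  case False
  have "\<exists>s. e \<le> norm (h_mat s ** Y ** adj (h_mat s))"
  proof (cases "Y$1$2 = 0")
    case True
    with False have "Y$1$1 \<noteq> 0" by simp
    define s where "s = (e - Y$2$1) / (2 * Y$1$1)"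
    have "(h_mat s ** Y ** adj (h_mat s))$2$1 = e"
      using \<open>Y$1$1 \<noteq> 0\<close> True tr by (simp add: mat2_mult_nth s_def field_simps)
    then show ?thesis using abs_nth_le_norm_mat2 by (metis abs_le_D1)
  next
    case nz: False
    define s where "s = (Y$1$1 - e) / Y$1$2"
    have "(h_mat s ** Y ** adj (h_mat s))$1$1 = e"
      using nz by (simp add: mat2_mult_nth s_def field_simps)
    then show ?thesis using abs_nth_le_norm_mat2 by (metis abs_le_D1)
  qed
  then obtain s where s: "e \<le> norm (h_mat s ** Y ** adj (h_mat s))" by blast
  have "h_mat 0 ** Y ** adj (h_mat 0) = Y" by (simp add: mat2_eq_iff mat2_mult_nth)
  then have "norm (h_mat 0 ** Y ** adj (h_mat 0)) \<le> e" using assms(3) by simp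
  from path_conj_norm_attained[OF continuous_h_mat this s] show ?thesis
    using that det_h_mat by blast
next
  case True
  have c: "Y$2$1 \<noteq> 0" using True tr \<open>Y \<noteq> 0\<close> by (auto simp: mat2_eq_iff)
  define b where "b s = transpose (h_mat s)" for s
  have b: "b s$1$1 = 1" "b s$1$2 = s" "b s$2$1 = 0" "b s$2$2 = 1" for s
    by (simp_all add: b_def transpose_def)
  define s where "s = e / Y$2$1"
  have "(b s ** Y ** adj (b s))$1$1 = e"
    using True c by (simp add: mat2_mult_nth b s_def)
  then have s: "e \<le> norm (b s ** Y ** adj (b s))"
    using abs_nth_le_norm_mat2 by (metis abs_le_D1)
  define N where "N = b 1 - mat 1"
  have eq: "b = (\<lambda>s. mat 1 + s *\<^sub>R N)" by (rule ext) (simp add: mat2_eq_iff b N_def)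
  have cont: "continuous_on UNIV b" unfolding eq by (intro continuous_intros)
  have "b 0 ** Y ** adj (b 0) = Y" by (simp add: mat2_eq_iff mat2_mult_nth b)
  then have "norm (b 0 ** Y ** adj (b 0)) \<le> e" using assms(3) by simp
  from path_conj_norm_attained[OF cont this s] obtain t where "norm (b t ** Y ** adj (b t)) = e"
    by blast
  moreover have "det (b t) = 1" by (simp add: det_2 b)
  ultimately show ?thesis using that by blast
qed

lemma exists_stretch:
  fixes w :: "real^2"
  assumes "w \<noteq> 0" "1 \<le> \<sigma>"
  obtains b where "det b = 1" "b *v w = \<sigma> *\<^sub>R w" "norm b \<le> 2 * \<sigma>"
proof -
  define p q n where pqn: "p = w$1" "q = w$2" "n = p\<^sup>2 + q\<^sup>2"
  have n: "n > 0" using assms(1) by (auto simp: pqn vec_eq_iff[of w] forall_2 sum_power2_gt_zero_iff)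
  \<comment> \<open>The symmetric matrix with eigenvalue \<open>\<sigma>\<close> on \<open>w\<close> and \<open>1 / \<sigma>\<close> on its orthogonal complement.\<close>
  define b :: "real^2^2" where "b = vector [vector [(\<sigma> * p\<^sup>2 + q\<^sup>2 / \<sigma>) / n, (\<sigma> - 1 / \<sigma>) * p * q / n],
    vector [(\<sigma> - 1 / \<sigma>) * p * q / n, (\<sigma> * q\<^sup>2 + p\<^sup>2 / \<sigma>) / n]]"
  have b: "b$1$1 = (\<sigma> * p\<^sup>2 + q\<^sup>2 / \<sigma>) / n" "b$1$2 = (\<sigma> - 1 / \<sigma>) * p * q / n"
    "b$2$1 = (\<sigma> - 1 / \<sigma>) * p * q / n" "b$2$2 = (\<sigma> * q\<^sup>2 + p\<^sup>2 / \<sigma>) / n"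
    by (simp_all add: b_def)
  define \<mu> where "\<mu> = 1 / \<sigma>"
  have l: "\<sigma> * \<mu> = 1" "0 < \<sigma>" using assms(2) by (auto simp: \<mu>_def)
  have b': "n * b$1$1 = \<sigma> * p\<^sup>2 + \<mu> * q\<^sup>2" "n * b$1$2 = (\<sigma> - \<mu>) * p * q"
    "n * b$2$1 = (\<sigma> - \<mu>) * p * q" "n * b$2$2 = \<sigma> * q\<^sup>2 + \<mu> * p\<^sup>2"
    using n by (simp_all add: b \<mu>_def)
  have "n\<^sup>2 * det b = (n * b$1$1) * (n * b$2$2) - (n * b$1$2) * (n * b$2$1)"
    by (simp add: det_2 power2_eq_square algebra_simps)
  also have "\<dots> = (\<sigma> * \<mu>) * (p\<^sup>2 + q\<^sup>2)\<^sup>2" unfolding b' by algebra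
  finally have d: "det b = 1" using n l by (simp add: pqn(3)[symmetric])
  have "n * (b *v w)$1 = (n * b$1$1) * p + (n * b$1$2) * q"
    by (simp add: mat2_vec_nth pqn algebra_simps)
  also have "\<dots> = (p\<^sup>2 + q\<^sup>2) * (\<sigma> * p)" unfolding b' by algebra
  finally have e1: "(b *v w)$1 = \<sigma> * p" using n by (simp add: pqn(3)[symmetric])
  have "n * (b *v w)$2 = (n * b$2$1) * p + (n * b$2$2) * q"
    by (simp add: mat2_vec_nth pqn algebra_simps)
  also have "\<dots> = (p\<^sup>2 + q\<^sup>2) * (\<sigma> * q)" unfolding b' by algebra
  finally have e2: "(b *v w)$2 = \<sigma> * q" using n by (simp add: pqn(3)[symmetric])
  have "n\<^sup>2 * (norm b)\<^sup>2 = (n * b$1$1)\<^sup>2 + (n * b$1$2)\<^sup>2 + (n * b$2$1)\<^sup>2 + (n * b$2$2)\<^sup>2"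
    by (simp add: norm_mat2_sq power_mult_distrib algebra_simps)
  also have "\<dots> = (p\<^sup>2 + q\<^sup>2)\<^sup>2 * (\<sigma>\<^sup>2 + \<mu>\<^sup>2)" unfolding b' by algebra
  finally have "(norm b)\<^sup>2 = \<sigma>\<^sup>2 + \<mu>\<^sup>2" using n by (simp add: pqn(3)[symmetric])
  also have "\<dots> \<le> \<sigma>\<^sup>2 + \<sigma>\<^sup>2"
    using assms(2) by (intro add_mono power_mono order_refl) (auto simp: \<mu>_def divide_le_eq_1 intro: order_trans[of _ 1])
  also have "\<dots> \<le> (2 * \<sigma>)\<^sup>2" by (simp add: power_mult_distrib)
  finally have "norm b \<le> 2 * \<sigma>" by (rule power2_le_imp_le) (use l in simp)
  then show ?thesis
    using that[of b] d e1 e2 by (simp add: vec_eq_iff[of _ "\<sigma> *\<^sub>R w"] forall_2 pqn)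
qed

context discrete_subgroup_SL2
begin

text \<open>
  Each of these vectors is fixed up to sign by a parabolic element of \<open>\<Gamma>\<close>, and is normalised
  so that \<open>|g v|\<^sup>2\<close> is the size of this element seen from \<open>g\<close>. They play the role of the
  primitive vectors of \<open>\<int>\<^sup>2\<close> for \<open>SL(2,\<int>)\<close>; their directions are the parabolic fixed points.
\<close>

definition par_vecs :: "(real^2) set" where
  "par_vecs = {v. v \<noteq> 0 \<and> (\<exists>\<gamma>\<in>\<Gamma>. tlp \<gamma> = nilp v \<or> tlp \<gamma> = - nilp v)}"

lemma par_vecs_mult:
  assumes "\<gamma> \<in> \<Gamma>" "v \<in> par_vecs"
  shows "\<gamma> *v v \<in> par_vecs"
proof -
  obtain \<eta> where \<eta>: "\<eta> \<in> \<Gamma>" "tlp \<eta> = nilp v \<or> tlp \<eta> = - nilp v" and v: "v \<noteq> 0"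
    using assms by (auto simp: par_vecs_def)
  have "tlp (\<gamma> ** \<eta> ** adj \<gamma>) = nilp (\<gamma> *v v) \<or> tlp (\<gamma> ** \<eta> ** adj \<gamma>) = - nilp (\<gamma> *v v)"
    using \<eta>(2) assms(1) by (auto simp: tlp_conj nilp_conj conj_uminus)
  moreover have "\<gamma> ** \<eta> ** adj \<gamma> \<in> \<Gamma>" using \<eta>(1) assms(1) by simp
  moreover have "\<gamma> *v v \<noteq> 0"
  proof
    assume "\<gamma> *v v = 0"
    then have "adj \<gamma> *v (\<gamma> *v v) = 0" by simp
    then show False using v assms(1) by (simp add: matrix_vector_mul_assoc adj_left)
  qed
  ultimately show ?thesis unfolding par_vecs_def by blast
qed

lemma conj_size_par:
  assumes "tlp \<gamma> = nilp v \<or> tlp \<gamma> = - nilp v"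
  shows "conj_size g \<gamma> = (norm (g *v v))\<^sup>2"
  using assms by (auto simp: conj_size_def nilp_conj norm_nilp conj_uminus)

lemma par_vecs_norm_ge:
  obtains c where "c > 0" "\<And>v. v \<in> par_vecs \<Longrightarrow> c \<le> norm v"
proof (cases "par_vecs = {}")
  case True
  then show ?thesis using that[of 1] by simp
next
  case False
  have ne: "tlp \<gamma> \<noteq> 0" if "v \<noteq> 0" "tlp \<gamma> = nilp v \<or> tlp \<gamma> = - nilp v" for v \<gamma>
    using that norm_nilp[of v] by auto
  obtain \<gamma>\<^sub>0 where \<gamma>\<^sub>0: "\<gamma>\<^sub>0 \<in> \<Gamma>" "tlp \<gamma>\<^sub>0 \<noteq> 0" using False ne by (auto simp: par_vecs_def)
  have "det (mat 1 :: real^2^2) = 1" by simp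
  from obtain_minimal[OF this \<gamma>\<^sub>0] obtain \<mu> where \<mu>: "tlp \<mu> \<noteq> 0"
    "\<And>\<gamma>. \<gamma> \<in> \<Gamma> \<Longrightarrow> tlp \<gamma> \<noteq> 0 \<Longrightarrow> conj_size (mat 1) \<mu> \<le> conj_size (mat 1) \<gamma>"
    by metis
  show ?thesis
  proof (rule that[of "sqrt (norm (tlp \<mu>))"])
    show "0 < sqrt (norm (tlp \<mu>))" using \<mu>(1) by simp
    fix v assume "v \<in> par_vecs"
    then obtain \<gamma> where \<gamma>: "\<gamma> \<in> \<Gamma>" "v \<noteq> 0" "tlp \<gamma> = nilp v \<or> tlp \<gamma> = - nilp v"
      by (auto simp: par_vecs_def)
    then have "norm (tlp \<mu>) \<le> (norm v)\<^sup>2"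
      using \<mu>(2)[OF \<gamma>(1) ne[OF \<gamma>(2,3)]] conj_size_par[OF \<gamma>(3), of "mat 1"] by simp
    then show "sqrt (norm (tlp \<mu>)) \<le> norm v" by (simp add: real_le_lsqrt)
  qed
qed

text \<open>
  By the invariance under \<open>\<Gamma>\<close> and the lower bound on the norm of a parabolic vector, a point
  that sees a short one is far out.
\<close>

lemma par_vecs_depth_bound:
  obtains c where "c > 0"
    "\<And>g \<gamma> v. det g = 1 \<Longrightarrow> \<gamma> \<in> \<Gamma> \<Longrightarrow> v \<in> par_vecs \<Longrightarrow> c \<le> norm (g ** \<gamma>) * norm (g *v v)"
proof -
  obtain c where c: "c > 0" "\<And>v. v \<in> par_vecs \<Longrightarrow> c \<le> norm v"
    by (rule par_vecs_norm_ge) blast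
  show ?thesis
  proof (rule that[OF c(1)])
    fix g \<gamma> :: "real^2^2" and v assume a: "det g = 1" "\<gamma> \<in> \<Gamma>" "v \<in> par_vecs"
    have "c \<le> norm (adj \<gamma> *v v)" using a by (intro c(2) par_vecs_mult) auto
    also have "adj \<gamma> *v v = adj (g ** \<gamma>) *v (g *v v)"
    proof -
      have "adj (g ** \<gamma>) ** g = adj \<gamma>"
        using a(1) by (simp add: adj_mult matrix_mul_assoc[symmetric] adj_left)
      then show ?thesis by (simp add: matrix_vector_mul_assoc)
    qed
    also have "norm \<dots> \<le> norm (adj (g ** \<gamma>)) * norm (g *v v)" by (rule norm_mat2_vec_le)
    finally show "c \<le> norm (g ** \<gamma>) * norm (g *v v)" by simp
  qed
qed

end

context finite_volume_SL2
begin

text \<open>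
  Conversely, a point far out in the quotient sees a parabolic vector that is correspondingly
  short. A smallest element of small size can be brought to a fixed size by moving the point;
  the new point lies in the thick part, which is bounded. So only finitely many conjugacy
  classes occur, and this excludes elements of trace close, but not equal, to \<open>\<plusminus>2\<close>. For
  the remaining, parabolic elements the distance of the move is explicit.
\<close>

lemma par_vecs_short:
  assumes unbounded: "\<And>R. \<exists>g. det g = 1 \<and> (\<forall>\<gamma>\<in>\<Gamma>. R < norm (g ** \<gamma>))"
  obtains C where "C > 0"
    "\<And>g. det g = 1 \<Longrightarrow> \<exists>\<gamma>\<in>\<Gamma>. \<exists>v\<in>par_vecs. norm (g ** \<gamma>) * norm (g *v v) \<le> C"
proof -
  define e :: real where "e = 1/16"
  obtain R where R: "R > 0"
    "\<And>g. det g = 1 \<Longrightarrow> (\<And>\<gamma>. \<gamma> \<in> \<Gamma> \<Longrightarrow> tlp \<gamma> \<noteq> 0 \<Longrightarrow> e \<le> conj_size g \<gamma>) \<Longrightarrow> \<exists>\<gamma>\<in>\<Gamma>. norm (g ** \<gamma>) \<le> R"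
    using thick_bounded[of e] by (auto simp: e_def)
  define minimal where "minimal g \<gamma> \<longleftrightarrow> \<gamma> \<in> \<Gamma> \<and> tlp \<gamma> \<noteq> 0 \<and>
    (\<forall>\<gamma>'\<in>\<Gamma>. tlp \<gamma>' \<noteq> 0 \<longrightarrow> conj_size g \<gamma> \<le> conj_size g \<gamma>')" for g \<gamma>
  \<comment> \<open>A point at which a smallest element has size \<open>e\<close>, below the Zassenhaus constant, lies
    in the thick part.\<close>
  have pushed: "\<exists>\<gamma>\<^sub>1\<in>\<Gamma>. norm (b ** g ** \<gamma>\<^sub>1) \<le> R"
    if "det g = 1" "det b = 1" "minimal g \<gamma>" "conj_size (b ** g) \<gamma> = e" for g b \<gamma>
  proof (rule R(2))
    show "det (b ** g) = 1" using that by (simp add: det_mul)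
    fix \<gamma>' assume "\<gamma>' \<in> \<Gamma>" "tlp \<gamma>' \<noteq> 0"
    then show "e \<le> conj_size (b ** g) \<gamma>'"
      using minimal_persists[OF that(1,2), of \<gamma> \<gamma>'] that(3,4) by (auto simp: minimal_def e_def)
  qed
  \<comment> \<open>Up to conjugation, \<open>\<Phi>\<close> contains the smallest elements at all these points.\<close>
  define \<Phi> where "\<Phi> = {\<gamma>\<in>\<Gamma>. conj_size (mat 1) \<gamma> \<le> R\<^sup>2 * e}"
  define D where "D = insert 1 ((\<lambda>\<gamma>. \<bar>det (tlp \<gamma>)\<bar>) ` {\<gamma>\<in>\<Phi>. det (tlp \<gamma>) \<noteq> 0})"
  define \<delta> where "\<delta> = Min D"
  have "finite \<Phi>" unfolding \<Phi>_def by (rule finite_conj_size_le) simp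
  then have D: "finite D" "D \<noteq> {}" by (auto simp: D_def)
  have \<delta>: "\<delta> > 0" using D by (simp add: \<delta>_def) (auto simp: D_def)
  define c' where "c' = min e (sqrt \<delta>)"
  have c': "c' > 0" "c' \<le> e" "c'\<^sup>2 \<le> \<delta>"
  proof -
    have "c'\<^sup>2 \<le> (sqrt \<delta>)\<^sup>2" by (intro power_mono) (use \<delta> in \<open>auto simp: c'_def e_def\<close>)
    then show "c'\<^sup>2 \<le> \<delta>" using \<delta> by simp
  qed (use \<delta> in \<open>auto simp: c'_def e_def\<close>)
  have parabolic: "det (tlp \<gamma>) = 0"
    if g: "det g = 1" and m: "minimal g \<gamma>" and small: "conj_size g \<gamma> < c'" for g \<gamma>
  proof (rule ccontr)
    assume nz: "det (tlp \<gamma>) \<noteq> 0"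
    have \<gamma>: "\<gamma> \<in> \<Gamma>" "tlp \<gamma> \<noteq> 0" using m by (auto simp: minimal_def)
    define Y where "Y = g ** tlp \<gamma> ** adj g"
    have nY: "norm Y = conj_size g \<gamma>" by (simp add: Y_def conj_size_def)
    have "Y = tlp (g ** \<gamma> ** adj g)" using g by (simp add: Y_def tlp_conj)
    then have tr: "Y$2$2 = - Y$1$1" by simp
    have "Y \<noteq> 0" using conj_size_pos[OF g \<gamma>(2)] nY by auto
    moreover have "norm Y \<le> e" using small c' nY by linarith
    ultimately obtain b where b: "det b = 1" "norm (b ** Y ** adj b) = e"
      by (rule conj_norm_attained[OF tr])
    then have se: "conj_size (b ** g) \<gamma> = e" by (simp add: conj_size_mult Y_def)
    obtain \<gamma>\<^sub>1 where \<gamma>\<^sub>1: "\<gamma>\<^sub>1 \<in> \<Gamma>" "norm (b ** g ** \<gamma>\<^sub>1) \<le> R" using pushed[OF g b(1) m se] by blast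
    define \<gamma>\<^sub>2 where "\<gamma>\<^sub>2 = adj \<gamma>\<^sub>1 ** \<gamma> ** \<gamma>\<^sub>1"
    have \<gamma>\<^sub>2: "\<gamma>\<^sub>2 \<in> \<Gamma>" using \<gamma>\<^sub>1 \<gamma> by (simp add: \<gamma>\<^sub>2_def)
    have "b ** g ** \<gamma>\<^sub>1 ** adj \<gamma>\<^sub>1 = b ** g"
      using \<gamma>\<^sub>1 by (simp add: matrix_mul_assoc[symmetric] adj_right)
    then have "conj_size (b ** g ** \<gamma>\<^sub>1) \<gamma>\<^sub>2 = e"
      using conj_size_conj[of \<gamma>\<^sub>1 "b ** g ** \<gamma>\<^sub>1" \<gamma>] \<gamma>\<^sub>1 se by (simp add: \<gamma>\<^sub>2_def)
    then have "norm (tlp \<gamma>\<^sub>2) \<le> (norm (b ** g ** \<gamma>\<^sub>1))\<^sup>2 * e"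
      using norm_tlp_le_conj_size[of "b ** g ** \<gamma>\<^sub>1" \<gamma>\<^sub>2] g b \<gamma>\<^sub>1 by (simp add: det_mul)
    also have "\<dots> \<le> R\<^sup>2 * e"
      using \<gamma>\<^sub>1 by (intro mult_right_mono power_mono) (auto simp: e_def)
    finally have "\<gamma>\<^sub>2 \<in> \<Phi>" using \<gamma>\<^sub>2 by (simp add: \<Phi>_def)
    have "tlp \<gamma>\<^sub>2 = adj \<gamma>\<^sub>1 ** tlp \<gamma> ** \<gamma>\<^sub>1"
      using tlp_conj[of "adj \<gamma>\<^sub>1" \<gamma>] \<gamma>\<^sub>1 by (simp add: \<gamma>\<^sub>2_def)
    then have "det (tlp \<gamma>\<^sub>2) = det (tlp \<gamma>)" using \<gamma>\<^sub>1 by (simp add: det_mul)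
    then have "\<bar>det (tlp \<gamma>)\<bar> \<in> D"
      using \<open>\<gamma>\<^sub>2 \<in> \<Phi>\<close> nz unfolding D_def by (intro insertI2 image_eqI[of _ _ \<gamma>\<^sub>2]) simp_all
    then have "\<delta> \<le> \<bar>det (tlp \<gamma>)\<bar>" using D by (simp add: \<delta>_def)
    also have "\<dots> = \<bar>det Y\<bar>" using g by (simp add: Y_def det_conj)
    also have "\<dots> < c'\<^sup>2"
    proof -
      have "(norm Y)\<^sup>2 < c'\<^sup>2" using small nY by (intro power_strict_mono) auto
      then show ?thesis using abs_det_mat2_le[of Y] by linarith
    qed
    finally show False using c' by simp
  qed
  have get_par: "\<exists>v\<in>par_vecs. tlp \<gamma> = nilp v \<or> tlp \<gamma> = - nilp v"
    if g: "det g = 1" and m: "minimal g \<gamma>" and small: "conj_size g \<gamma> < c'" for g \<gamma>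
  proof -
    have "tlp \<gamma>$2$2 = - tlp \<gamma>$1$1" by simp
    then obtain v where v: "tlp \<gamma> = nilp v \<or> tlp \<gamma> = - nilp v"
      using traceless_nilpotent_eq_nilp parabolic[OF g m small] by blast
    moreover have "v \<noteq> 0"
    proof
      assume "v = 0"
      then have "nilp v = 0" by (simp add: mat2_eq_iff)
      then show False using v m by (auto simp: minimal_def)
    qed
    ultimately show ?thesis using m unfolding par_vecs_def minimal_def by blast
  qed
  have get_minimal: "\<exists>\<gamma>. minimal g \<gamma> \<and> conj_size g \<gamma> < c'"
    if g: "det g = 1" and \<gamma>: "\<gamma> \<in> \<Gamma>" "tlp \<gamma> \<noteq> 0" "conj_size g \<gamma> < c'" for g \<gamma>
  proof -
    obtain \<mu> where \<mu>: "\<mu> \<in> \<Gamma>" "tlp \<mu> \<noteq> 0"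
      "\<And>\<gamma>'. \<gamma>' \<in> \<Gamma> \<Longrightarrow> tlp \<gamma>' \<noteq> 0 \<Longrightarrow> conj_size g \<mu> \<le> conj_size g \<gamma>'"
      using obtain_minimal[OF g \<gamma>(1,2)] by metis
    then show ?thesis using \<mu>(3)[OF \<gamma>(1,2)] \<gamma>(3) unfolding minimal_def by force
  qed
  obtain R' where R': "R' > 0"
    "\<And>g. det g = 1 \<Longrightarrow> (\<And>\<gamma>. \<gamma> \<in> \<Gamma> \<Longrightarrow> tlp \<gamma> \<noteq> 0 \<Longrightarrow> c' \<le> conj_size g \<gamma>) \<Longrightarrow> \<exists>\<gamma>\<in>\<Gamma>. norm (g ** \<gamma>) \<le> R'"
    using thick_bounded[OF c'(1)] by auto
  obtain v\<^sub>0 where v\<^sub>0: "v\<^sub>0 \<in> par_vecs"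
  proof -
    obtain g where g: "det g = 1" "\<forall>\<gamma>\<in>\<Gamma>. R' < norm (g ** \<gamma>)" using unbounded by blast
    then obtain \<gamma> where "\<gamma> \<in> \<Gamma>" "tlp \<gamma> \<noteq> 0" "conj_size g \<gamma> < c'"
      using R'(2)[OF g(1)] by (meson linorder_not_le)
    then show ?thesis using that get_minimal[OF g(1)] get_par[OF g(1)] by blast
  qed
  show ?thesis
  proof (rule that[of "R'\<^sup>2 * norm v\<^sub>0 + 2 * R"])
    show "0 < R'\<^sup>2 * norm v\<^sub>0 + 2 * R" using R(1) by (simp add: add_nonneg_pos)
    fix g :: "real^2^2" assume g: "det g = 1"
    show "\<exists>\<gamma>\<in>\<Gamma>. \<exists>v\<in>par_vecs. norm (g ** \<gamma>) * norm (g *v v) \<le> R'\<^sup>2 * norm v\<^sub>0 + 2 * R"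
    proof (cases "\<exists>\<gamma>\<in>\<Gamma>. tlp \<gamma> \<noteq> 0 \<and> conj_size g \<gamma> < c'")
      case False
      then obtain \<gamma> where \<gamma>: "\<gamma> \<in> \<Gamma>" "norm (g ** \<gamma>) \<le> R'"
        using R'(2)[OF g] by (meson linorder_not_le)
      have "norm (g *v (\<gamma> *v v\<^sub>0)) \<le> norm (g ** \<gamma>) * norm v\<^sub>0"
        using norm_mat2_vec_le[of "g ** \<gamma>" v\<^sub>0] by (simp add: matrix_vector_mul_assoc)
      also have "\<dots> \<le> R' * norm v\<^sub>0" using \<gamma> by (intro mult_right_mono) auto
      finally have "norm (g ** \<gamma>) * norm (g *v (\<gamma> *v v\<^sub>0)) \<le> R' * (R' * norm v\<^sub>0)"
        using \<gamma> R'(1) by (intro mult_mono) auto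
      then have "norm (g ** \<gamma>) * norm (g *v (\<gamma> *v v\<^sub>0)) \<le> R'\<^sup>2 * norm v\<^sub>0 + 2 * R"
        using R(1) by (simp add: power2_eq_square mult.assoc)
      then show ?thesis using \<gamma>(1) par_vecs_mult[OF \<gamma>(1) v\<^sub>0] by blast
    next
      case True
      then obtain \<gamma> where \<gamma>: "minimal g \<gamma>" "conj_size g \<gamma> < c'" using get_minimal[OF g] by blast
      then obtain v where v: "v \<in> par_vecs" "tlp \<gamma> = nilp v \<or> tlp \<gamma> = - nilp v"
        using get_par[OF g] by blast
      define w where "w = g *v v"
      have sw: "conj_size g \<gamma> = (norm w)\<^sup>2" using conj_size_par[OF v(2)] by (simp add: w_def)
      have "0 < (norm w)\<^sup>2" using conj_size_pos[OF g, of \<gamma>] \<gamma>(1) sw by (auto simp: minimal_def)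
      then have w: "w \<noteq> 0" by auto
      have "(norm w)\<^sup>2 \<le> (1/4)\<^sup>2" using sw \<gamma>(2) c' by (simp add: e_def power2_eq_square)
      then have wle: "norm w \<le> 1/4" by (rule power2_le_imp_le) simp
      \<comment> \<open>Stretching \<open>w\<close> to the norm \<open>1/4\<close> brings the parabolic element to the size \<open>e = (1/4)\<^sup>2\<close>.\<close>
      define \<sigma> where "\<sigma> = 1 / (4 * norm w)"
      have \<sigma>: "1 \<le> \<sigma>" "\<sigma> * norm w = 1/4" using w wle by (auto simp: \<sigma>_def field_simps)
      obtain b where b: "det b = 1" "b *v w = \<sigma> *\<^sub>R w" "norm b \<le> 2 * \<sigma>"
        using exists_stretch[OF w \<sigma>(1)] .
      have "conj_size (b ** g) \<gamma> = (norm ((b ** g) *v v))\<^sup>2" by (rule conj_size_par[OF v(2)])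
      also have "(b ** g) *v v = \<sigma> *\<^sub>R w" using b(2) by (simp add: w_def matrix_vector_mul_assoc)
      also have "norm (\<sigma> *\<^sub>R w) = 1/4" using \<sigma> by simp
      also have "(1/4)\<^sup>2 = e" by (simp add: e_def power2_eq_square)
      finally obtain \<gamma>\<^sub>1 where \<gamma>\<^sub>1: "\<gamma>\<^sub>1 \<in> \<Gamma>" "norm (b ** g ** \<gamma>\<^sub>1) \<le> R"
        using pushed[OF g b(1) \<gamma>(1)] by blast
      have "g ** \<gamma>\<^sub>1 = adj b ** (b ** g ** \<gamma>\<^sub>1)"
        using b(1) by (simp add: matrix_mul_assoc[symmetric] adj_left_mult)
      then have "norm (g ** \<gamma>\<^sub>1) \<le> norm b * norm (b ** g ** \<gamma>\<^sub>1)"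
        using norm_mat2_mult_le[of "adj b" "b ** g ** \<gamma>\<^sub>1"] by simp
      also have "\<dots> \<le> (2 * \<sigma>) * R" using \<sigma> b \<gamma>\<^sub>1 by (intro mult_mono) auto
      finally have "norm (g ** \<gamma>\<^sub>1) * norm w \<le> ((2 * \<sigma>) * R) * norm w" by (rule mult_right_mono) simp
      also have "\<dots> = 2 * R * (\<sigma> * norm w)" by simp
      also have "\<dots> \<le> R'\<^sup>2 * norm v\<^sub>0 + 2 * R" unfolding \<sigma>(2) using R(1) by (simp add: add_nonneg_pos)
      finally show ?thesis using \<gamma>\<^sub>1(1) v(1) unfolding w_def by blast
    qed
  qed
qed

end

section \<open>The quotient space\<close>

context discrete_subgroup_SL2
begin

lemma l_coset_mult:
  assumes "det a = 1" "det g = 1"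
  shows "a <#\<^bsub>SL2R\<^esub> (g <#\<^bsub>SL2R\<^esub> \<Gamma>) = (a ** g) <#\<^bsub>SL2R\<^esub> \<Gamma>"
  using group.lcos_m_assoc[OF group_SL2R subgroup.subset[OF subgroup], of a g] assms by simp

lemma coset_eqI:
  assumes "\<gamma> \<in> \<Gamma>" "a = g ** \<gamma>"
  shows "a <#\<^bsub>SL2R\<^esub> \<Gamma> = g <#\<^bsub>SL2R\<^esub> \<Gamma>"
proof (intro equalityI subsetI)
  fix b assume "b \<in> a <#\<^bsub>SL2R\<^esub> \<Gamma>"
  then obtain \<eta> where "\<eta> \<in> \<Gamma>" "b = a ** \<eta>" by (auto simp: mem_coset_iff)
  then show "b \<in> g <#\<^bsub>SL2R\<^esub> \<Gamma>"
    using assms unfolding mem_coset_iff by (intro bexI[of _ "\<gamma> ** \<eta>"]) (simp_all add: matrix_mul_assoc)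
next
  fix b assume "b \<in> g <#\<^bsub>SL2R\<^esub> \<Gamma>"
  then obtain \<eta> where \<eta>: "\<eta> \<in> \<Gamma>" "b = g ** \<eta>" by (auto simp: mem_coset_iff)
  have "b = a ** (adj \<gamma> ** \<eta>)"
    using assms by (simp add: \<eta> matrix_mul_assoc[symmetric] adj_right_mult)
  then show "b \<in> a <#\<^bsub>SL2R\<^esub> \<Gamma>"
    using assms \<eta> unfolding mem_coset_iff by (intro bexI[of _ "adj \<gamma> ** \<eta>"]) simp_all
qed

lemma compact_space_if_bounded:
  assumes "\<And>g. det g = 1 \<Longrightarrow> \<exists>\<gamma>\<in>\<Gamma>. norm (g ** \<gamma>) \<le> R"
  shows "compact_space (coset_topology \<Gamma>)"
proof -
  let ?q = "\<lambda>g. g <#\<^bsub>SL2R\<^esub> \<Gamma>"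
  define K where "K = cball 0 R \<inter> {A::real^2^2. det A = 1}"
  have "closed {A::real^2^2. det A = 1}"
    by (intro closed_Collect_eq continuous_det_mat2 continuous_intros)
  then have "compact K" unfolding K_def by (intro compact_Int_closed compact_cball)
  then have "compactin (top_of_set (carrier SL2R)) K"
    by (auto simp: compactin_subtopology K_def)
  then have "compactin (coset_topology \<Gamma>) (?q ` K)"
    by (rule image_compactin) (rule quotient_imp_continuous_map[OF quotient_map_coset_topology])
  moreover have "?q ` K = topspace (coset_topology \<Gamma>)"
  proof -
    have "?q ` carrier SL2R \<subseteq> ?q ` K"
    proof clarify
      fix g assume "g \<in> carrier SL2R"
      then have g: "det g = 1" by simp
      then obtain \<gamma> where \<gamma>: "\<gamma> \<in> \<Gamma>" "norm (g ** \<gamma>) \<le> R" using assms by blast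
      then have "g ** \<gamma> \<in> K" using g by (simp add: K_def det_mul)
      then show "?q g \<in> ?q ` K"
        using coset_eqI[OF \<gamma>(1) refl, of g] by (intro image_eqI[of _ _ "g ** \<gamma>"]) simp_all
    qed
    moreover have "?q ` K \<subseteq> ?q ` carrier SL2R" by (auto simp: K_def)
    ultimately show ?thesis
      using quotient_imp_surjective_map[OF quotient_map_coset_topology, of \<Gamma>] by simp
  qed
  ultimately show ?thesis by (simp add: compact_space_def)
qed

lemma closed_compact_mult:
  assumes K: "compact K" "K \<subseteq> {A. det A = 1}"
  shows "closed {k ** \<gamma> | k \<gamma>. k \<in> K \<and> \<gamma> \<in> \<Gamma>}"
proof -
  let ?Q = "{k ** \<gamma> | k \<gamma>. k \<in> K \<and> \<gamma> \<in> \<Gamma>}"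
  have "x \<in> ?Q" if f: "\<And>n. f n \<in> ?Q" "f \<longlonglongrightarrow> x" for f :: "nat \<Rightarrow> real^2^2" and x
  proof -
    have "\<forall>n. \<exists>k \<gamma>. f n = k ** \<gamma> \<and> k \<in> K \<and> \<gamma> \<in> \<Gamma>" using f(1) by blast
    then obtain k \<gamma> where k\<gamma>: "\<And>n. f n = k n ** \<gamma> n" "\<And>n. k n \<in> K" "\<And>n. \<gamma> n \<in> \<Gamma>" by metis
    obtain l r where l: "l \<in> K" "strict_mono r" "(k \<circ> r) \<longlonglongrightarrow> l"
      using K(1) k\<gamma>(2) unfolding compact_def by blast
    have dk: "det (k n) = 1" for n using k\<gamma>(2) K(2) by blast
    have "bounded_linear adj" using linear_adj by (simp add: linear_conv_bounded_linear)
    then have "(\<lambda>n. adj ((k \<circ> r) n)) \<longlonglongrightarrow> adj l" using l(3) by (rule bounded_linear.tendsto)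
    moreover have "(f \<circ> r) \<longlonglongrightarrow> x" using f(2) l(2) by (rule LIMSEQ_subseq_LIMSEQ)
    ultimately have "(\<lambda>n. adj ((k \<circ> r) n) ** (f \<circ> r) n) \<longlonglongrightarrow> adj l ** x"
      by (rule tendsto_mat2_mult)
    moreover have "adj ((k \<circ> r) n) ** (f \<circ> r) n = \<gamma> (r n)" for n
      using adj_left_mult[OF dk[of "r n"]] by (simp only: comp_apply k\<gamma>(1))
    ultimately have "(\<lambda>n. \<gamma> (r n)) \<longlonglongrightarrow> adj l ** x" by simp
    then have "adj l ** x \<in> \<Gamma>"
      using closed_sequentially[OF closed, of "\<lambda>n. \<gamma> (r n)"] k\<gamma>(3) by auto
    moreover have "x = l ** (adj l ** x)" using l(1) K(2) by (simp add: subset_iff adj_right_mult)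
    ultimately show ?thesis using l(1) by blast
  qed
  then show ?thesis unfolding closed_sequential_limits by blast
qed

text \<open>
  A parabolic vector that \<open>g\<close> makes vertical gives a parabolic element of the stabiliser of
  \<open>x = g \<Gamma>\<close> inside \<open>H\<close>. The orbit \<open>H x\<close> is then a closed horocycle.
\<close>

lemma cuspidal_if_vertical:
  assumes g: "det g = 1" and v: "v \<in> par_vecs" and vert: "(g *v v)$1 = 0"
  shows "cuspidal \<Gamma> (g <#\<^bsub>SL2R\<^esub> \<Gamma>)"
proof -
  \<comment> \<open>The periods of the orbit.\<close>
  define S where "S = {s. \<exists>\<gamma>\<in>\<Gamma>. h_mat s ** g = g ** \<gamma>}"
  have S_add: "s + t \<in> S" if "s \<in> S" "t \<in> S" for s t
  proof -
    obtain \<gamma> \<eta> where \<gamma>: "\<gamma> \<in> \<Gamma>" "h_mat s ** g = g ** \<gamma>" and \<eta>: "\<eta> \<in> \<Gamma>" "h_mat t ** g = g ** \<eta>"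
      using \<open>s \<in> S\<close> \<open>t \<in> S\<close> by (auto simp: S_def)
    have "h_mat (s + t) ** g = h_mat s ** (h_mat t ** g)"
      by (simp add: matrix_mul_assoc h_mat_add)
    also have "\<dots> = g ** (\<gamma> ** \<eta>)" by (simp add: \<gamma> \<eta> matrix_mul_assoc)
    finally show ?thesis unfolding S_def using \<gamma> \<eta> by (auto intro!: bexI[of _ "\<gamma> ** \<eta>"])
  qed
  have S_uminus: "- s \<in> S" if "s \<in> S" for s
  proof -
    obtain \<gamma> where \<gamma>: "\<gamma> \<in> \<Gamma>" "h_mat s ** g = g ** \<gamma>" using \<open>s \<in> S\<close> by (auto simp: S_def)
    have "g ** adj \<gamma> = (h_mat (- s) ** (h_mat s ** g)) ** adj \<gamma>"
      by (simp add: matrix_mul_assoc h_mat_add)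
    also have "\<dots> = h_mat (- s) ** g"
      using \<gamma>(1) unfolding \<gamma>(2) by (simp add: matrix_mul_assoc[symmetric] adj_right)
    finally show ?thesis unfolding S_def using \<gamma> by (auto intro!: bexI[of _ "adj \<gamma>"])
  qed
  have S_0: "0 \<in> S" unfolding S_def by (auto intro!: bexI[of _ "mat 1"])
  have S_nat: "real n * s \<in> S" if "s \<in> S" for n s
    by (induction n) (use S_0 S_add that in \<open>auto simp: algebra_simps\<close>)
  have S_int: "of_int n * s \<in> S" if "s \<in> S" for n s
    using S_nat[OF that, of "nat n"] S_uminus[OF S_nat[OF that, of "nat (- n)"]]
    by (cases "n \<ge> 0") auto
  obtain T where T: "T \<in> S" "T > 0"
  proof -
    obtain \<gamma> where \<gamma>: "\<gamma> \<in> \<Gamma>" "tlp \<gamma> = nilp v \<or> tlp \<gamma> = - nilp v" and "v \<noteq> 0"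
      using v by (auto simp: par_vecs_def)
    define B where "B = g ** \<gamma> ** adj g"
    define q where "q = (g *v v)$2"
    have q: "q \<noteq> 0"
    proof
      assume "q = 0"
      then have "g *v v = 0" using vert by (simp add: vec_eq_iff forall_2 q_def)
      then have "adj g *v (g *v v) = 0" by simp
      then show False using \<open>v \<noteq> 0\<close> g by (simp add: matrix_vector_mul_assoc adj_left)
    qed
    have "tlp B = nilp (g *v v) \<or> tlp B = - nilp (g *v v)"
      using \<gamma>(2) g by (auto simp: B_def tlp_conj nilp_conj conj_uminus)
    then have e: "tlp B$1$1 = 0" "tlp B$1$2 = 0" "tlp B$2$1 = q\<^sup>2 \<or> tlp B$2$1 = - q\<^sup>2"
      using vert by (auto simp: q_def mat2_eq_iff)
    then have B: "B$1$1 = B$2$2" "B$1$2 = 0" "B$2$1 \<noteq> 0" using q by auto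
    have "det B = 1" using g \<gamma>(1) by (simp add: B_def det_conj)
    then have B1: "B$2$2 * B$2$2 = 1" using B by (simp add: det_2)
    define T where "T = 2 * B$2$1 * B$2$2"
    \<comment> \<open>The square removes the sign of the parabolic element.\<close>
    have "B ** B = h_mat T" using B B1 by (simp add: mat2_eq_iff mat2_mult_nth T_def)
    moreover have "B ** B ** g = g ** (\<gamma> ** \<gamma>)"
      using g by (simp add: B_def matrix_mul_assoc[symmetric] adj_left_mult adj_left)
    ultimately have "T \<in> S" unfolding S_def using \<gamma>(1) by (auto intro!: bexI[of _ "\<gamma> ** \<gamma>"])
    moreover have "T \<noteq> 0" using B B1 by (auto simp: T_def)
    ultimately show ?thesis using that[of T] that[of "- T"] S_uminus by fastforce
  qed
  define K where "K = (\<lambda>s. h_mat s ** g) ` {0..T}"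
  define Q where "Q = {k ** \<gamma> | k \<gamma>. k \<in> K \<and> \<gamma> \<in> \<Gamma>}"
  have "compact K" unfolding K_def
    by (intro compact_continuous_image continuous_on_mat2_mult continuous_h_mat continuous_on_const compact_Icc)
  moreover have K1: "K \<subseteq> {A. det A = 1}" using g by (auto simp: K_def det_mul)
  ultimately have "closed Q" unfolding Q_def by (rule closed_compact_mult)
  let ?x = "g <#\<^bsub>SL2R\<^esub> \<Gamma>" and ?q = "\<lambda>g. g <#\<^bsub>SL2R\<^esub> \<Gamma>"
  let ?O = "range (\<lambda>s. h_mat s <#\<^bsub>SL2R\<^esub> ?x)"
  have hx: "h_mat s <#\<^bsub>SL2R\<^esub> ?x = ?q (h_mat s ** g)" for s using g by (simp add: l_coset_mult)
  have "{a \<in> carrier SL2R. ?q a \<in> ?O} = Q"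
  proof (intro equalityI subsetI)
    fix a assume a: "a \<in> {a \<in> carrier SL2R. ?q a \<in> ?O}"
    then obtain s where "?q a = ?q (h_mat s ** g)" using hx by auto
    moreover have "a \<in> ?q a" unfolding mem_coset_iff by (intro bexI[of _ "mat 1"]) simp_all
    ultimately obtain \<gamma> where \<gamma>: "\<gamma> \<in> \<Gamma>" "a = h_mat s ** g ** \<gamma>" by (auto simp: mem_coset_iff)
    define n where "n = \<lfloor>s / T\<rfloor>"
    define s' where "s' = s - of_int n * T"
    have "of_int n \<le> s / T" "s / T < of_int n + 1" unfolding n_def by linarith+
    then have s': "0 \<le> s'" "s' \<le> T" using T(2) by (simp_all add: s'_def field_simps)
    obtain \<eta> where \<eta>: "\<eta> \<in> \<Gamma>" "h_mat (of_int n * T) ** g = g ** \<eta>"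
      using S_int[OF T(1), of n] by (auto simp: S_def)
    have "h_mat s = h_mat s' ** h_mat (of_int n * T)" by (simp add: h_mat_add s'_def)
    then have "a = h_mat s' ** (h_mat (of_int n * T) ** g) ** \<gamma>"
      using \<gamma>(2) by (simp add: matrix_mul_assoc)
    also have "\<dots> = (h_mat s' ** g) ** (\<eta> ** \<gamma>)" by (simp add: \<eta>(2) matrix_mul_assoc)
    finally have "a = (h_mat s' ** g) ** (\<eta> ** \<gamma>)" .
    moreover have "h_mat s' ** g \<in> K" unfolding K_def using s' by auto
    moreover have "\<eta> ** \<gamma> \<in> \<Gamma>" using \<eta> \<gamma> by simp
    ultimately show "a \<in> Q" unfolding Q_def by blast
  next
    fix a assume "a \<in> Q"
    then obtain s \<gamma> where a: "a = h_mat s ** g ** \<gamma>" "\<gamma> \<in> \<Gamma>" by (auto simp: Q_def K_def)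
    then have "?q a = h_mat s <#\<^bsub>SL2R\<^esub> ?x" using coset_eqI hx by metis
    moreover have "det a = 1" using a g by (simp add: det_mul)
    ultimately show "a \<in> {a \<in> carrier SL2R. ?q a \<in> ?O}" by auto
  qed
  moreover have "Q \<subseteq> carrier SL2R" using K1 by (auto simp: Q_def det_mul)
  ultimately have "closedin (top_of_set (carrier SL2R)) {a \<in> carrier SL2R. ?q a \<in> ?O}"
    using \<open>closed Q\<close> by (simp add: closed_subset)
  moreover have "?O \<subseteq> topspace (coset_topology \<Gamma>)"
    using quotient_imp_surjective_map[OF quotient_map_coset_topology, of \<Gamma>] g
    by (auto simp: hx det_mul)
  ultimately have "closedin (coset_topology \<Gamma>) ?O"
    using quotient_map_coset_topology[of \<Gamma>] unfolding quotient_map_closedin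
    by simp
  then show ?thesis by (simp add: cuspidal_def)
qed

end

section \<open>The distance on the orbifold\<close>

lemma moebius_adj_i:
  assumes "det g = 1"
  shows "moebius (adj g) \<i> = Complex (- (g$1$1 * g$1$2 + g$2$1 * g$2$2) / ((g$1$1)\<^sup>2 + (g$2$1)\<^sup>2))
    (1 / ((g$1$1)\<^sup>2 + (g$2$1)\<^sup>2))" (is "_ = ?z")
proof -
  define n where "n = (g$1$1)\<^sup>2 + (g$2$1)\<^sup>2"
  have d: "g$1$1 * g$2$2 - g$1$2 * g$2$1 = 1" using assms by (simp add: det_2)
  have "g$1$1 \<noteq> 0 \<or> g$2$1 \<noteq> 0" using d by auto
  then have n: "n > 0" by (auto simp: n_def sum_power2_gt_zero_iff)
  let ?den = "of_real (- g$2$1) * \<i> + of_real (g$1$1) :: complex"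
  have "?den \<noteq> 0" using \<open>g$1$1 \<noteq> 0 \<or> g$2$1 \<noteq> 0\<close> by (auto simp: complex_eq_iff)
  moreover have "of_real (g$2$2) * \<i> + of_real (- g$1$2) = ?z * ?den"
  proof -
    have "- g$1$2 * n = - (g$1$1 * g$1$2 + g$2$1 * g$2$2) * g$1$1 + g$2$1"
      using d unfolding n_def by algebra
    moreover have "g$2$2 * n = (g$1$1 * g$1$2 + g$2$1 * g$2$2) * g$2$1 + g$1$1"
      using d unfolding n_def by algebra
    ultimately show ?thesis
      using n unfolding n_def[symmetric] by (simp add: complex_eq_iff field_simps)
  qed
  ultimately show ?thesis
    unfolding moebius_def adj_nth by (simp only: nonzero_mult_div_cancel_right not_False_eq_True)
qed

lemma hyp_dist_eq_norm:
  assumes "det g = 1" "det k = 1"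
  shows "hyp_dist (moebius (adj g) \<i>) (moebius (adj k) \<i>) = arcosh ((norm (g ** adj k))\<^sup>2 / 2)"
proof -
  define n N X where nNX: "n = (g$1$1)\<^sup>2 + (g$2$1)\<^sup>2" "N = (g$1$2)\<^sup>2 + (g$2$2)\<^sup>2"
    "X = g$1$1 * g$1$2 + g$2$1 * g$2$2"
  define n' N' X' where nNX': "n' = (k$1$1)\<^sup>2 + (k$2$1)\<^sup>2" "N' = (k$1$2)\<^sup>2 + (k$2$2)\<^sup>2"
    "X' = k$1$1 * k$1$2 + k$2$1 * k$2$2"
  have dg: "g$1$1 * g$2$2 - g$1$2 * g$2$1 = 1" and dk: "k$1$1 * k$2$2 - k$1$2 * k$2$1 = 1"
    using assms by (simp_all add: det_2)
  have "g$1$1 \<noteq> 0 \<or> g$2$1 \<noteq> 0" "k$1$1 \<noteq> 0 \<or> k$2$1 \<noteq> 0" using dg dk by auto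
  then have n: "n > 0" "n' > 0" by (auto simp: nNX nNX' sum_power2_gt_zero_iff)
  have X: "X\<^sup>2 + 1 = n * N" "X'\<^sup>2 + 1 = n' * N'"
    using dg dk unfolding nNX nNX' by algebra+
  have "(cmod (moebius (adj g) \<i> - moebius (adj k) \<i>))\<^sup>2 = (X / n - X' / n')\<^sup>2 + (1 / n - 1 / n')\<^sup>2"
    unfolding moebius_adj_i[OF assms(1)] moebius_adj_i[OF assms(2)] nNX(1,3)[symmetric] nNX'(1,3)[symmetric]
      cmod_power2
    by (simp add: power2_eq_square algebra_simps)
  moreover have "2 * Im (moebius (adj g) \<i>) * Im (moebius (adj k) \<i>) = 2 / (n * n')"
    unfolding moebius_adj_i[OF assms(1)] moebius_adj_i[OF assms(2)] nNX(1)[symmetric] nNX'(1)[symmetric]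
    by simp
  moreover have "((X / n - X' / n')\<^sup>2 + (1 / n - 1 / n')\<^sup>2) / (2 / (n * n'))
      = (n' * ((X\<^sup>2 + 1) / n) + n * ((X'\<^sup>2 + 1) / n') - 2 * X * X' - 2) / 2"
    using n by (simp add: field_simps power2_eq_square)
  moreover have "(X\<^sup>2 + 1) / n = N" "(X'\<^sup>2 + 1) / n' = N'" using X n by simp_all
  moreover have "1 + (n' * N + n * N' - 2 * X * X' - 2) / 2 = (norm (g ** adj k))\<^sup>2 / 2"
    unfolding norm_mat2_sq mat2_mult_nth adj_nth nNX nNX' by (simp add: field_simps power2_eq_square)
  ultimately show ?thesis unfolding hyp_dist_def by (simp only:)
qed

lemma arcosh_le_ln: "1 \<le> x \<Longrightarrow> arcosh x \<le> ln (2 * x)" for x :: real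
proof -
  assume x: "1 \<le> x"
  have "sqrt (x\<^sup>2 - 1) \<le> x" using x by (intro real_le_lsqrt) auto
  moreover have "0 \<le> sqrt (x\<^sup>2 - 1)" using x by (simp add: power_le_one)
  ultimately have "ln (x + sqrt (x\<^sup>2 - 1)) \<le> ln (2 * x)"
    using x by (subst ln_le_cancel_iff) linarith+
  then show ?thesis using x by (simp add: arcosh_real_def)
qed

lemma ln_le_arcosh: "1 \<le> x \<Longrightarrow> ln x \<le> arcosh x" for x :: real
proof -
  assume x: "1 \<le> x"
  have "0 \<le> sqrt (x\<^sup>2 - 1)" using x by (simp add: power_le_one)
  then have "ln x \<le> ln (x + sqrt (x\<^sup>2 - 1))"
    using x by (subst ln_le_cancel_iff) linarith+
  then show ?thesis using x by (simp add: arcosh_real_def)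
qed

context discrete_subgroup_SL2
begin

lemma orbifold_dist_eq:
  assumes g: "det g = 1" and k: "det k = 1"
  shows "orbifold_dist (g <#\<^bsub>SL2R\<^esub> \<Gamma>) (k <#\<^bsub>SL2R\<^esub> \<Gamma>)
    = (INF \<gamma>\<in>\<Gamma>. arcosh ((norm (g ** \<gamma> ** adj k))\<^sup>2 / 2))"
proof -
  define d where "d = (\<lambda>\<gamma>. arcosh ((norm (g ** \<gamma> ** adj k))\<^sup>2 / 2))"
  have proj: "orbifold_proj (a <#\<^bsub>SL2R\<^esub> \<Gamma>) = (\<lambda>\<gamma>. moebius (adj (a ** \<gamma>)) \<i>) ` \<Gamma>" if "det a = 1" for a
  proof -
    have "a <#\<^bsub>SL2R\<^esub> \<Gamma> = (\<lambda>\<gamma>. a ** \<gamma>) ` \<Gamma>" by (auto simp: mem_coset_iff)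
    then show ?thesis using that by (auto simp: orbifold_proj_def image_iff inv_SL2R det_mul)
  qed
  have hd: "hyp_dist (moebius (adj (g ** \<gamma>)) \<i>) (moebius (adj (k ** \<eta>)) \<i>) = d (\<gamma> ** adj \<eta>)"
    if "\<gamma> \<in> \<Gamma>" "\<eta> \<in> \<Gamma>" for \<gamma> \<eta>
  proof -
    have "det (g ** \<gamma>) = 1" "det (k ** \<eta>) = 1" using that g k by (simp_all add: det_mul)
    from hyp_dist_eq_norm[OF this] show ?thesis by (simp add: d_def adj_mult matrix_mul_assoc)
  qed
  have "(\<lambda>(z, w). hyp_dist z w) ` (orbifold_proj (g <#\<^bsub>SL2R\<^esub> \<Gamma>) \<times> orbifold_proj (k <#\<^bsub>SL2R\<^esub> \<Gamma>)) = d ` \<Gamma>"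
  proof (intro equalityI subsetI)
    fix y assume "y \<in> (\<lambda>(z, w). hyp_dist z w) ` (orbifold_proj (g <#\<^bsub>SL2R\<^esub> \<Gamma>) \<times> orbifold_proj (k <#\<^bsub>SL2R\<^esub> \<Gamma>))"
    then obtain \<gamma> \<eta> where "\<gamma> \<in> \<Gamma>" "\<eta> \<in> \<Gamma>"
      "y = hyp_dist (moebius (adj (g ** \<gamma>)) \<i>) (moebius (adj (k ** \<eta>)) \<i>)"
      unfolding proj[OF g] proj[OF k] by auto
    then have "y = d (\<gamma> ** adj \<eta>)" "\<gamma> ** adj \<eta> \<in> \<Gamma>" using hd by simp_all
    then show "y \<in> d ` \<Gamma>" by blast
  next
    fix y assume "y \<in> d ` \<Gamma>"
    then obtain \<gamma> where \<gamma>: "\<gamma> \<in> \<Gamma>" "y = d \<gamma>" by blast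
    have "adj (mat 1) = mat 1" by (simp add: mat2_eq_iff)
    then have "y = hyp_dist (moebius (adj (g ** \<gamma>)) \<i>) (moebius (adj (k ** mat 1)) \<i>)"
      using hd[OF \<gamma>(1) one_in] \<gamma>(2) by simp
    then show "y \<in> (\<lambda>(z, w). hyp_dist z w) ` (orbifold_proj (g <#\<^bsub>SL2R\<^esub> \<Gamma>) \<times> orbifold_proj (k <#\<^bsub>SL2R\<^esub> \<Gamma>))"
      unfolding proj[OF g] proj[OF k]
      using \<gamma>(1) one_in
      by (intro image_eqI[of _ _ "(moebius (adj (g ** \<gamma>)) \<i>, moebius (adj (k ** mat 1)) \<i>)"]
          SigmaI imageI) (simp_all only: prod.case)
  qed
  then show ?thesis unfolding orbifold_dist_def d_def by simp
qed

text \<open>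
  Up to a bounded error, the distance of \<open>g \<Gamma>\<close> from a fixed point is the infimum of
  \<open>2 ln |g \<gamma>|\<close> over \<open>\<gamma> \<in> \<Gamma>\<close>.
\<close>

lemma orbifold_dist_bounds:
  assumes k: "det k = 1"
  obtains C where "\<And>g. det g = 1 \<Longrightarrow> 0 \<le> orbifold_dist (g <#\<^bsub>SL2R\<^esub> \<Gamma>) (k <#\<^bsub>SL2R\<^esub> \<Gamma>)"
    "\<And>g \<gamma>. det g = 1 \<Longrightarrow> \<gamma> \<in> \<Gamma> \<Longrightarrow> orbifold_dist (g <#\<^bsub>SL2R\<^esub> \<Gamma>) (k <#\<^bsub>SL2R\<^esub> \<Gamma>) \<le> 2 * ln (norm (g ** \<gamma>)) + C"
    "\<And>g. det g = 1 \<Longrightarrow> \<exists>\<gamma>\<in>\<Gamma>. 2 * ln (norm (g ** \<gamma>)) \<le> orbifold_dist (g <#\<^bsub>SL2R\<^esub> \<Gamma>) (k <#\<^bsub>SL2R\<^esub> \<Gamma>) + C"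
proof -
  define C where "C = 2 * ln (norm k) + ln 2 + 1"
  have ln2: "0 < ln (2::real)" by simp
  have ge1: "1 \<le> (norm (g ** \<gamma> ** adj k))\<^sup>2 / 2" if "det g = 1" "\<gamma> \<in> \<Gamma>" for g \<gamma>
    using norm_det1_ge[of "g ** \<gamma> ** adj k"] that k by (simp add: det_mul)
  have bdd: "bdd_below ((\<lambda>\<gamma>. arcosh ((norm (g ** \<gamma> ** adj k))\<^sup>2 / 2)) ` \<Gamma>)" if "det g = 1" for g
    using ge1[OF that] by (intro bdd_belowI[of _ 0]) auto
  have ne: "\<Gamma> \<noteq> {}" using one_in by blast
  show ?thesis
  proof (rule that[of C])
    fix g :: "real^2^2" assume g: "det g = 1"
    show "0 \<le> orbifold_dist (g <#\<^bsub>SL2R\<^esub> \<Gamma>) (k <#\<^bsub>SL2R\<^esub> \<Gamma>)"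
      unfolding orbifold_dist_eq[OF g k] using ne ge1[OF g] by (intro cINF_greatest) auto
    let ?D = "orbifold_dist (g <#\<^bsub>SL2R\<^esub> \<Gamma>) (k <#\<^bsub>SL2R\<^esub> \<Gamma>)"
    show "\<exists>\<gamma>\<in>\<Gamma>. 2 * ln (norm (g ** \<gamma>)) \<le> ?D + C"
    proof -
      have "?D < ?D + 1" by simp
      then obtain \<gamma> where \<gamma>: "\<gamma> \<in> \<Gamma>" "arcosh ((norm (g ** \<gamma> ** adj k))\<^sup>2 / 2) < ?D + 1"
        unfolding orbifold_dist_eq[OF g k] by (subst (asm) cINF_less_iff[OF ne bdd[OF g]]) blast
      let ?M = "g ** \<gamma> ** adj k"
      have M: "1 \<le> norm ?M" using g k \<gamma> by (intro norm_det1_ge1) (simp add: det_mul)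
      have "g ** \<gamma> = ?M ** k" using k by (simp add: matrix_mul_assoc[symmetric] adj_left)
      then have 1: "2 * ln (norm (g ** \<gamma>)) \<le> 2 * ln (norm ?M) + 2 * ln (norm k)"
        using ln_norm_mat2_mult_le[of ?M k] g \<gamma> k by (simp add: det_mul)
      have "?M \<noteq> 0" using M by auto
      then have "2 * ln (norm ?M) - ln 2 = ln ((norm ?M)\<^sup>2 / 2)"
        by (simp add: ln_div ln_realpow)
      also have "\<dots> \<le> arcosh ((norm ?M)\<^sup>2 / 2)" by (rule ln_le_arcosh[OF ge1[OF g \<gamma>(1)]])
      finally show ?thesis using 1 \<gamma> unfolding C_def by (intro bexI[of _ \<gamma>]) linarith
    qed
  next
    fix g \<gamma> :: "real^2^2" assume g: "det g = 1" and \<gamma>: "\<gamma> \<in> \<Gamma>"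
    let ?M = "g ** \<gamma> ** adj k"
    have M: "1 \<le> norm ?M" using g k \<gamma> by (intro norm_det1_ge1) (simp add: det_mul)
    have "orbifold_dist (g <#\<^bsub>SL2R\<^esub> \<Gamma>) (k <#\<^bsub>SL2R\<^esub> \<Gamma>) \<le> arcosh ((norm ?M)\<^sup>2 / 2)"
      unfolding orbifold_dist_eq[OF g k] by (rule cINF_lower[OF bdd[OF g] \<gamma>])
    also have "\<dots> \<le> ln ((norm ?M)\<^sup>2)" using arcosh_le_ln[OF ge1[OF g \<gamma>]] by simp
    also have "\<dots> = 2 * ln (norm ?M)" using M by (simp add: ln_realpow)
    also have "\<dots> \<le> 2 * (ln (norm (g ** \<gamma>)) + ln (norm k))"
      using ln_norm_mat2_mult_le[of "g ** \<gamma>" "adj k"] g \<gamma> k by (simp add: det_mul)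
    also have "\<dots> \<le> 2 * ln (norm (g ** \<gamma>)) + C" using ln2 by (simp add: C_def)
    finally show "orbifold_dist (g <#\<^bsub>SL2R\<^esub> \<Gamma>) (k <#\<^bsub>SL2R\<^esub> \<Gamma>) \<le> 2 * ln (norm (g ** \<gamma>)) + C" .
  qed
qed

end

section \<open>The limit superior\<close>

text \<open>
  The comparison of growth rates, for the distances \<open>f s\<close> and \<open>\<phi> t\<close> along a horocycle and
  along a geodesic. Up to bounded errors, in the last hypothesis the geodesic is at time \<open>t\<close> in a cusp, where it
  will climb for a further time \<open>\<beta>\<close>; the horocycle then climbs into this cusp to the height
  \<open>t + \<beta>\<close> above the peak \<open>\<phi> t + \<beta>\<close> of the geodesic, and by the time \<open>e\<^bsup>t + \<beta>\<^esup>\<close>.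
\<close>

lemma limsup_growth:
  fixes f \<phi> :: "real \<Rightarrow> real"
  assumes f0: "\<And>s. 0 \<le> f s" and \<phi>0: "\<And>t. 0 \<le> \<phi> t"
    and f_bound: "\<And>s. f s \<le> ln (2 + s\<^sup>2) + C"
    and \<phi>_bound: "\<And>t. 0 \<le> t \<Longrightarrow> \<phi> t \<le> t + C"
    and upper: "\<And>s. 1 < \<bar>s\<bar> \<Longrightarrow> f s \<le> \<phi> (ln \<bar>s\<bar>) + ln \<bar>s\<bar> + C"
    and lower: "\<And>t. 0 \<le> t \<Longrightarrow> \<exists>s \<beta>. 0 \<le> \<beta> \<and> \<phi> t + t + 2 * \<beta> - C \<le> f s \<and> (s \<noteq> 0 \<longrightarrow> ln \<bar>s\<bar> \<le> t + \<beta>)"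
  shows "Limsup at_infinity (\<lambda>s. ereal (f s / ln \<bar>s\<bar>)) = 1 + Limsup at_top (\<lambda>t. ereal (\<phi> t / t))"
proof (rule antisym)
  define L where "L = Limsup at_top (\<lambda>t. ereal (\<phi> t / t))"
  have "0 \<le> L" unfolding L_def
  proof (rule le_Limsup)
    show "\<forall>\<^sub>F t in at_top. 0 \<le> ereal (\<phi> t / t)"
      using eventually_ge_at_top[of 0] by eventually_elim (use \<phi>0 in auto)
  qed simp
  show "Limsup at_infinity (\<lambda>s. ereal (f s / ln \<bar>s\<bar>)) \<le> 1 + L"
    unfolding Limsup_le_iff
  proof (intro allI impI)
    fix y assume y: "1 + L < y"
    then obtain l where l: "L = ereal l" using \<open>0 \<le> L\<close> by (cases L) auto
    obtain z where z: "1 + l < z" "ereal z < y"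
      using y ereal_dense2[of "1 + L" y] by (auto simp: l one_ereal_def)
    define \<epsilon> where "\<epsilon> = (z - 1 - l) / 2"
    have \<epsilon>: "\<epsilon> > 0" using z by (simp add: \<epsilon>_def)
    have "\<forall>\<^sub>F t in at_top. ereal (\<phi> t / t) < ereal (l + \<epsilon>)"
      using \<epsilon> l unfolding L_def by (intro Limsup_lessD) simp
    moreover have "\<forall>\<^sub>F t in at_top. \<bar>C\<bar> / \<epsilon> < t" by (rule eventually_gt_at_top)
    moreover have "\<forall>\<^sub>F t in at_top. (0::real) < t" by (rule eventually_gt_at_top)
    ultimately have "\<forall>\<^sub>F t in at_top. 0 < t \<and> \<phi> t + t + C < z * t"
    proof eventually_elim
      case (elim t)
      then have "\<phi> t < (l + \<epsilon>) * t" by (simp add: pos_divide_less_eq)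
      moreover have "\<bar>C\<bar> < \<epsilon> * t" using elim \<epsilon> by (simp add: pos_divide_less_eq mult.commute)
      moreover have "z * t = (l + \<epsilon>) * t + t + \<epsilon> * t" by (simp add: \<epsilon>_def field_simps)
      ultimately show ?case using elim by linarith
    qed
    moreover have "filterlim (\<lambda>s::real. ln \<bar>s\<bar>) at_top at_infinity"
      using filterlim_compose[OF ln_at_top filterlim_norm_at_top[where 'a=real]] by simp
    ultimately have "\<forall>\<^sub>F s in at_infinity. 0 < ln \<bar>s::real\<bar> \<and> \<phi> (ln \<bar>s\<bar>) + ln \<bar>s\<bar> + C < z * ln \<bar>s\<bar>"
      unfolding filterlim_iff by blast
    moreover have "\<forall>\<^sub>F s::real in at_infinity. 2 \<le> norm s"
      unfolding eventually_at_infinity by blast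
    ultimately show "\<forall>\<^sub>F s in at_infinity. ereal (f s / ln \<bar>s\<bar>) < y"
    proof eventually_elim
      case (elim s)
      then have "f s < z * ln \<bar>s\<bar>" using upper[of s] by simp
      then have "f s / ln \<bar>s\<bar> < z" using elim by (simp add: pos_divide_less_eq)
      then show ?case using z(2) by (meson ereal_less(2) less_ereal.simps(1) order_less_trans)
    qed
  qed
  show "1 + L \<le> Limsup at_infinity (\<lambda>s. ereal (f s / ln \<bar>s\<bar>))"
  proof (rule ccontr)
    assume "\<not> ?thesis"
    then have "Limsup at_infinity (\<lambda>s. ereal (f s / ln \<bar>s\<bar>)) < 1 + L" by simp
    then obtain z where z: "Limsup at_infinity (\<lambda>s. ereal (f s / ln \<bar>s\<bar>)) < ereal z" "ereal z < 1 + L"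
      using ereal_dense2 by blast
    obtain z' where z': "z < z'" "ereal z' < 1 + L" using ereal_dense2[OF z(2)] by auto
    obtain B where B: "\<And>s. B \<le> \<bar>s\<bar> \<Longrightarrow> f s / ln \<bar>s\<bar> < z"
      using Limsup_lessD[OF z(1)] by (auto simp: eventually_at_infinity)
    define B' where "B' = max B 3"
    have "0 \<le> f B' / ln \<bar>B'\<bar>" using f0 by (simp add: B'_def)
    also have "\<dots> < z" by (rule B) (simp add: B'_def)
    finally have "0 < z" .
    \<comment> \<open>Beyond \<open>T\<close>, the horocycle times of the last hypothesis exceed \<open>B'\<close>, and the gap between
      \<open>z\<close> and \<open>z'\<close> absorbs \<open>C\<close>.\<close>
    define T where "T = Max {1, ln (2 + B'\<^sup>2) + 2 * C + 1, (C + 1) / (z' - z)}"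
    have "\<not> (\<forall>\<^sub>F t in at_top. ereal (\<phi> t / t) \<le> ereal (z' - 1))"
    proof
      assume "\<forall>\<^sub>F t in at_top. ereal (\<phi> t / t) \<le> ereal (z' - 1)"
      then have "L \<le> ereal (z' - 1)" unfolding L_def by (rule Limsup_bounded)
      then have "1 + L \<le> 1 + ereal (z' - 1)" by (rule add_left_mono)
      then show False using z'(2) by (simp add: one_ereal_def)
    qed
    then obtain t where t: "T \<le> t" "z' - 1 < \<phi> t / t"
      unfolding eventually_at_top_linorder by (force simp: not_le)
    have t1: "1 \<le> t" "ln (2 + B'\<^sup>2) + 2 * C + 1 \<le> t" "(C + 1) / (z' - z) \<le> t"
      using t(1) by (simp_all add: T_def)
    have "(z' - 1) * t < \<phi> t" using t(2) t1 by (simp add: pos_less_divide_eq)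
    then have \<phi>t: "z' * t < \<phi> t + t" by (simp add: algebra_simps)
    have gap: "C < (z' - z) * t"
      using t1(3) z' by (simp add: pos_divide_le_eq mult.commute)
    have "z < 2"
    proof -
      have "z' * t < 2 * t + C" using \<phi>t \<phi>_bound[of t] t1 by simp
      then have "z * t < 2 * t" using gap by (simp add: algebra_simps)
      then show ?thesis using t1 by simp
    qed
    obtain s \<beta> where s: "0 \<le> \<beta>" "\<phi> t + t + 2 * \<beta> - C \<le> f s" "s \<noteq> 0 \<longrightarrow> ln \<bar>s\<bar> \<le> t + \<beta>"
      using lower[of t] t1 by auto
    have "B' < \<bar>s\<bar>"
    proof (rule ccontr)
      assume "\<not> ?thesis"
      then have "\<bar>s\<bar>\<^sup>2 \<le> B'\<^sup>2" by (intro power_mono) auto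
      then have "ln (2 + s\<^sup>2) \<le> ln (2 + B'\<^sup>2)" by (subst ln_le_cancel_iff) (simp_all add: add_pos_nonneg)
      then show False using f_bound[of s] s(1,2) \<phi>0[of t] t1(2) by linarith
    qed
    then have s3: "B \<le> \<bar>s\<bar>" "3 < \<bar>s\<bar>" by (auto simp: B'_def)
    then have "0 < ln \<bar>s\<bar>" by (intro ln_gt_zero) auto
    then have "f s < z * ln \<bar>s\<bar>" using B[OF s3(1)] by (simp add: pos_divide_less_eq)
    also have "\<dots> \<le> z * (t + \<beta>)" using s(3) s3 \<open>0 < z\<close> by (intro mult_left_mono) auto
    also have "\<dots> \<le> z * t + 2 * \<beta>"
      using mult_right_mono[of z 2 \<beta>] \<open>z < 2\<close> s(1) by (simp add: distrib_left)
    finally show False using s(2) \<phi>t gap by (simp add: algebra_simps)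
  qed
qed

section \<open>Growth along the horocycle\<close>

theorem theorem2p10:
  fixes \<Gamma> x x\<^sub>0 :: "(real^2^2) set"
  assumes "nonuniform_lattice \<Gamma>"
    and "x\<^sub>0 \<in> lcosets\<^bsub>SL2R\<^esub> \<Gamma>"
    and "x \<in> lcosets\<^bsub>SL2R\<^esub> \<Gamma>"
    and "\<not> cuspidal \<Gamma> x"
  shows "Limsup at_infinity (\<lambda>s::real. ereal (orbifold_dist (h_mat s <#\<^bsub>SL2R\<^esub> x) x\<^sub>0 / ln \<bar>s\<bar>)) =
         1 + Limsup at_top (\<lambda>t::real. ereal (orbifold_dist (g_mat t <#\<^bsub>SL2R\<^esub> x) x\<^sub>0 / t))"
proof -
  obtain F where "subgroup \<Gamma> SL2R" "discrete \<Gamma>" "fundamental_domain \<Gamma> F" "emeasure haar_SL2R F < \<infinity>"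
    and noncompact: "\<not> compact_space (coset_topology \<Gamma>)"
    using assms(1) by (auto simp: nonuniform_lattice_def)
  then interpret finite_volume_SL2 \<Gamma> F
    by (intro finite_volume_SL2.intro discrete_subgroup_SL2.intro finite_volume_SL2_axioms.intro)
  obtain g k where g: "det g = 1" "x = g <#\<^bsub>SL2R\<^esub> \<Gamma>" and k: "det k = 1" "x\<^sub>0 = k <#\<^bsub>SL2R\<^esub> \<Gamma>"
    using assms(2,3) by (auto simp: LCOSETS_def)
  have "\<exists>a. det a = 1 \<and> (\<forall>\<gamma>\<in>\<Gamma>. R < norm (a ** \<gamma>))" for R
    using compact_space_if_bounded[of R] noncompact by (meson linorder_not_le)
  then obtain C\<^sub>1 where C\<^sub>1: "C\<^sub>1 > 0"
    "\<And>a. det a = 1 \<Longrightarrow> \<exists>\<gamma>\<in>\<Gamma>. \<exists>v\<in>par_vecs. norm (a ** \<gamma>) * norm (a *v v) \<le> C\<^sub>1"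
    using par_vecs_short by blast
  obtain c where c: "c > 0"
    "\<And>a \<gamma> v. det a = 1 \<Longrightarrow> \<gamma> \<in> \<Gamma> \<Longrightarrow> v \<in> par_vecs \<Longrightarrow> c \<le> norm (a ** \<gamma>) * norm (a *v v)"
    using par_vecs_depth_bound by blast
  define D where "D a = orbifold_dist ((a ** g) <#\<^bsub>SL2R\<^esub> \<Gamma>) x\<^sub>0" for a
  obtain C\<^sub>0 where D0: "\<And>a. det a = 1 \<Longrightarrow> 0 \<le> D a"
    and D_le: "\<And>a \<gamma>. det a = 1 \<Longrightarrow> \<gamma> \<in> \<Gamma> \<Longrightarrow> D a \<le> 2 * ln (norm (a ** g ** \<gamma>)) + C\<^sub>0"
    and D_ge: "\<And>a. det a = 1 \<Longrightarrow> \<exists>\<gamma>\<in>\<Gamma>. 2 * ln (norm (a ** g ** \<gamma>)) \<le> D a + C\<^sub>0"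
  proof -
    obtain C where C: "\<And>a. det a = 1 \<Longrightarrow> 0 \<le> orbifold_dist (a <#\<^bsub>SL2R\<^esub> \<Gamma>) (k <#\<^bsub>SL2R\<^esub> \<Gamma>)"
      "\<And>a \<gamma>. det a = 1 \<Longrightarrow> \<gamma> \<in> \<Gamma> \<Longrightarrow> orbifold_dist (a <#\<^bsub>SL2R\<^esub> \<Gamma>) (k <#\<^bsub>SL2R\<^esub> \<Gamma>) \<le> 2 * ln (norm (a ** \<gamma>)) + C"
      "\<And>a. det a = 1 \<Longrightarrow> \<exists>\<gamma>\<in>\<Gamma>. 2 * ln (norm (a ** \<gamma>)) \<le> orbifold_dist (a <#\<^bsub>SL2R\<^esub> \<Gamma>) (k <#\<^bsub>SL2R\<^esub> \<Gamma>) + C"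
      using orbifold_dist_bounds[OF k(1)] by metis
    have dg: "det (a ** g) = 1" if "det a = 1" for a using that g(1) by (simp add: det_mul)
    show ?thesis
      by (rule that[of C]) (use C dg in \<open>auto simp: D_def k(2)\<close>)
  qed
  define G where "G = ln (norm g)"
  have G: "0 \<le> G" unfolding G_def using norm_det1_ge1[OF g(1)] by simp
  define l\<^sub>2 l\<^sub>3 where l: "l\<^sub>2 = ln (2::real)" "l\<^sub>3 = ln (3::real)"
  define B\<^sub>0 B\<^sub>1 B\<^sub>2 where B: "B\<^sub>0 = \<bar>C\<^sub>0\<bar>" "B\<^sub>1 = \<bar>ln C\<^sub>1\<bar>" "B\<^sub>2 = \<bar>ln c\<bar>"
  define C where "C = 2 * G + 2 * B\<^sub>0 + l\<^sub>2 + l\<^sub>3 + 2 * B\<^sub>1 + 2 * B\<^sub>2"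
  have const_bounds: "0 < l\<^sub>2" "0 < l\<^sub>3" "0 \<le> B\<^sub>0" "0 \<le> B\<^sub>1" "0 \<le> B\<^sub>2"
    "C\<^sub>0 \<le> B\<^sub>0" "ln C\<^sub>1 \<le> B\<^sub>1" "- ln c \<le> B\<^sub>2"
    by (simp_all add: B l)
  have D_le_ag: "D a \<le> 2 * ln (norm a) + 2 * G + C\<^sub>0" if "det a = 1" for a
    using D_le[OF that one_in] ln_norm_mat2_mult_le[OF that g(1)] by (simp add: G_def)
  have "Limsup at_infinity (\<lambda>s. ereal (D (h_mat s) / ln \<bar>s\<bar>)) = 1 + Limsup at_top (\<lambda>t. ereal (D (g_mat t) / t))"
  proof (rule limsup_growth[of "\<lambda>s. D (h_mat s)" "\<lambda>t. D (g_mat t)" C])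
    show "0 \<le> D (h_mat s)" "0 \<le> D (g_mat t)" for s t by (simp_all add: D0)
    show "D (h_mat s) \<le> ln (2 + s\<^sup>2) + C" for s
    proof -
      have "2 * ln (norm (h_mat s)) = ln ((norm (h_mat s))\<^sup>2)"
        using norm_det1_ge1[of "h_mat s"] by (simp add: ln_realpow)
      then show ?thesis
        using D_le_ag[OF det_h_mat, of s] G const_bounds unfolding norm_h_mat_sq C_def by linarith
    qed
    show "D (g_mat t) \<le> t + C" if "0 \<le> t" for t
      using D_le_ag[OF det_g_mat, of t] two_ln_norm_g_mat_le[of t, folded l] G const_bounds that unfolding C_def by linarith
    show "D (h_mat s) \<le> D (g_mat (ln \<bar>s\<bar>)) + ln \<bar>s\<bar> + C" if s: "1 < \<bar>s\<bar>" for s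
    proof -
      define t where "t = ln \<bar>s\<bar>"
      have t: "0 < t" using s by (simp add: t_def)
      obtain \<gamma> where \<gamma>: "\<gamma> \<in> \<Gamma>" "2 * ln (norm (g_mat t ** g ** \<gamma>)) \<le> D (g_mat t) + C\<^sub>0"
        using D_ge[of "g_mat t"] by auto
      have hs: "h_mat s ** g ** \<gamma> = g_mat (- t) ** (h_mat (sgn s) ** (g_mat t ** g ** \<gamma>))"
        using s h_mat_eq_conj[of s] by (cases "s = 0") (simp_all add: t_def matrix_mul_assoc)
      have d: "det (g_mat t ** g ** \<gamma>) = 1" using g \<gamma> by (simp add: det_mul)
      have "ln (norm (h_mat s ** g ** \<gamma>)) \<le> ln (norm (g_mat (- t))) + ln (norm (h_mat (sgn s) ** (g_mat t ** g ** \<gamma>)))"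
        unfolding hs using d by (intro ln_norm_mat2_mult_le) (simp_all add: det_mul[of "h_mat _"])
      also have "\<dots> \<le> ln (norm (g_mat (- t))) + (ln (norm (h_mat (sgn s))) + ln (norm (g_mat t ** g ** \<gamma>)))"
        using d by (intro add_left_mono ln_norm_mat2_mult_le) simp_all
      finally have "2 * ln (norm (h_mat s ** g ** \<gamma>)) \<le>
        2 * ln (norm (g_mat (- t))) + 2 * ln (norm (h_mat (sgn s))) + 2 * ln (norm (g_mat t ** g ** \<gamma>))"
        by simp
      moreover have "2 * ln (norm (h_mat (sgn s))) = l\<^sub>3"
      proof -
        have "2 * ln (norm (h_mat (sgn s))) = ln ((norm (h_mat (sgn s)))\<^sup>2)"
          using norm_det1_ge1[of "h_mat (sgn s)"] by (simp add: ln_realpow)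
        also have "(norm (h_mat (sgn s)))\<^sup>2 = 3"
          using s unfolding norm_h_mat_sq by (cases "s > 0") auto
        finally show ?thesis by (simp add: l)
      qed
      moreover have "D (h_mat s) \<le> 2 * ln (norm (h_mat s ** g ** \<gamma>)) + C\<^sub>0"
        using D_le[of "h_mat s" \<gamma>] \<gamma> by simp
      moreover have "2 * ln (norm (g_mat (- t))) \<le> t + l\<^sub>2"
        using two_ln_norm_g_mat_le[of "- t"] t by (simp add: l)
      ultimately show ?thesis using \<gamma>(2) G const_bounds unfolding t_def[symmetric] C_def by linarith
    qed
    show "\<exists>s \<beta>. 0 \<le> \<beta> \<and> D (g_mat t) + t + 2 * \<beta> - C \<le> D (h_mat s) \<and> (s \<noteq> 0 \<longrightarrow> ln \<bar>s\<bar> \<le> t + \<beta>)"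
      if "0 \<le> t" for t
    proof -
      have dt: "det (g_mat t ** g) = 1" using g by (simp add: det_mul)
      obtain \<gamma> v where \<gamma>: "\<gamma> \<in> \<Gamma>" and v: "v \<in> par_vecs"
        and le: "norm (g_mat t ** g ** \<gamma>) * norm ((g_mat t ** g) *v v) \<le> C\<^sub>1"
        using C\<^sub>1(2)[OF dt] by blast
      define m where "m = norm (g_mat t ** g ** \<gamma>)"
      define p q where pq: "p = (g *v v)$1" "q = (g *v v)$2"
      have m: "1 \<le> m" unfolding m_def using dt \<gamma> by (intro norm_det1_ge1) (simp add: det_mul)
      have p: "p \<noteq> 0" using cuspidal_if_vertical[OF g(1) v] assms(4) g(2) by (auto simp: pq)
      have comp: "(g_mat t ** g) *v v = g_mat t *v (g *v v)" by (simp add: matrix_vector_mul_assoc)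
      have bound: "\<bar>((g_mat t ** g) *v v)$i\<bar> \<le> C\<^sub>1 / m" for i
      proof -
        have "\<bar>((g_mat t ** g) *v v)$i\<bar> * m \<le> norm ((g_mat t ** g) *v v) * m"
          using m by (intro mult_right_mono component_le_norm_cart) simp
        also have "\<dots> \<le> C\<^sub>1" using le by (simp add: m_def mult.commute)
        finally show ?thesis using m by (subst pos_le_divide_eq) linarith+
      qed
      have pb: "exp (t/2) * \<bar>p\<bar> \<le> C\<^sub>1 / m" and qb: "exp (- t/2) * \<bar>q\<bar> \<le> C\<^sub>1 / m"
        using bound[of 1] bound[of 2] unfolding comp by (simp_all add: mat2_vec_nth pq abs_mult)
      have lnb: "ln \<bar>r\<bar> \<le> ln C\<^sub>1 - ln m - u" if "r \<noteq> 0" "exp u * \<bar>r\<bar> \<le> C\<^sub>1 / m" for u r :: real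
      proof -
        have "ln (exp u * \<bar>r\<bar>) \<le> ln (C\<^sub>1 / m)" using that by (subst ln_le_cancel_iff) (use m C\<^sub>1 in auto)
        then show ?thesis using that m C\<^sub>1 by (simp add: ln_mult ln_div)
      qed
      \<comment> \<open>The time at which \<open>h\<^sub>s\<close> makes the vector \<open>(p, q)\<close> horizontal.\<close>
      define s where "s = - q / p"
      have "h_mat s *v (g *v v) = vector [p, 0]"
        unfolding vec_eq_iff[of _ "vector [p, 0]"] forall_2 mat2_vec_nth[of "h_mat s"] pq[symmetric]
        using p by (simp add: s_def)
      then have "(norm ((h_mat s ** g) *v v))\<^sup>2 = p\<^sup>2"
        by (simp add: norm_vec2_sq matrix_vector_mul_assoc[symmetric])
      then have np: "norm ((h_mat s ** g) *v v) = \<bar>p\<bar>"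
        using power2_eq_imp_eq[of "norm ((h_mat s ** g) *v v)" "\<bar>p\<bar>"] by simp
      obtain \<eta> where \<eta>: "\<eta> \<in> \<Gamma>" "2 * ln (norm (h_mat s ** g ** \<eta>)) \<le> D (h_mat s) + C\<^sub>0"
        using D_ge[of "h_mat s"] by auto
      have "c \<le> norm (h_mat s ** g ** \<eta>) * \<bar>p\<bar>"
        using c(2)[of "h_mat s ** g" \<eta> v] g \<eta> v np by (simp add: det_mul)
      moreover have "1 \<le> norm (h_mat s ** g ** \<eta>)" using g \<eta> by (intro norm_det1_ge1) (simp add: det_mul)
      ultimately have "ln c \<le> ln (norm (h_mat s ** g ** \<eta>)) + ln \<bar>p\<bar>"
        using c(1) p ln_mult[of "norm (h_mat s ** g ** \<eta>)" "\<bar>p\<bar>"]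
        by (smt (verit) ln_le_cancel_iff zero_less_abs_iff)
      then have Dh: "2 * ln c - 2 * ln \<bar>p\<bar> - C\<^sub>0 \<le> D (h_mat s)" using \<eta>(2) by linarith
      define \<beta> where "\<beta> = - ln \<bar>p\<bar> - t/2 - ln m + ln C\<^sub>1"
      have "0 \<le> \<beta>" using lnb[OF p pb] by (simp add: \<beta>_def)
      moreover have "D (g_mat t) + t + 2 * \<beta> - C \<le> D (h_mat s)"
      proof -
        have "D (g_mat t) \<le> 2 * ln m + C\<^sub>0" using D_le[of "g_mat t" \<gamma>] \<gamma> by (simp add: m_def)
        moreover have "t + 2 * \<beta> = 2 * ln C\<^sub>1 - 2 * ln \<bar>p\<bar> - 2 * ln m" by (simp add: \<beta>_def)
        moreover have "2 * C\<^sub>0 + 2 * ln C\<^sub>1 - 2 * ln c \<le> C" using G const_bounds unfolding C_def by linarith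
        ultimately show ?thesis using Dh by linarith
      qed
      moreover have "s \<noteq> 0 \<longrightarrow> ln \<bar>s\<bar> \<le> t + \<beta>"
      proof
        assume "s \<noteq> 0"
        then have q: "q \<noteq> 0" by (auto simp: s_def)
        have "ln \<bar>s\<bar> = ln \<bar>q\<bar> - ln \<bar>p\<bar>" using p q by (simp add: s_def abs_divide ln_div)
        then show "ln \<bar>s\<bar> \<le> t + \<beta>" using lnb[OF q qb] by (simp add: \<beta>_def)
      qed
      ultimately show ?thesis by blast
    qed
  qed
  then show ?thesis using g by (simp add: D_def l_coset_mult)
qed

end
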